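(* Let $d\ge 1$ be an integer, $\sigma\in[1,\infty]$, $0<r\le 1/2$, and let $n\ge q\ge 2$ be integers. Let $\Theta(Q_n^{(\sigma,d)}(r),q)$ denote the probability that a fixed labeled cycle of length $q$ is present in the geometric random graph $Q_n^{(\sigma,d)}(r)$. Then \[ \Theta(Q_n^{(\sigma,d)}(r),q)=\begin{cases}\beta_{d,\sigma,r} & \text{if } q=2,\\[2pt] \displaystyle\sum_{\mathbf m\in\mathbb Z^d}\hat{\Xi}_{B_{d,\sigma,r}(\mathbf 0)}(2\pi\mathbf m)^q & \text{if } q>2.\end{cases} \]
   Context: The $d$-dimensional unit torus is $T_d=\mathbb R^d/\mathbb Z^d$ (identified with $[0,1]^d$). For $\sigma\in[1,\infty]$ and $r>0$, $B_{d,\sigma,r}(\mathbf 0)=\{\mathbf x\in\mathbb R^d:\|\mathbf x\|_\sigma\le r\}$, with $\|\cdot\|_\sigma$ the $L_\sigma$ norm. The geometric random graph $Q_n^{(\sigma,d)}(r)$ has vertex set $\{1,\dots,n\}$, where vertex $i$ is associated with a point $\mathbf x_i$, the points $\mathbf x_1,\dots,\mathbf x_n$ being independent and uniformly distributed in $T_d$; distinct vertices $i,j$ are adjacent iff $\|\mathbf x_i-\mathbf x_j\|_\sigma\le r$, where the distance is measured on the torus, i.e. $\min_{\mathbf u\in\mathbb Z^d}\|\mathbf x_i-\mathbf x_j-\mathbf u\|_\sigma\le r$. $\beta_{d,\sigma,r}$ is the probability that two given vertices are adjacent; for $0<r\le1/2$ it equals the Lebesgue volume of $B_{d,\sigma,r}(\mathbf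 0)$. A labeled cycle of length $q$ is a sequence of distinct vertices $y_1,\dots,y_q$; it is present if $\{y_i,y_{i+1}\}$ is an edge for $i=1,\dots,q-1$ and $\{y_q,y_1\}$ is an edge (for $q=2$ this is a single edge). $\Xi_S$ denotes the indicator function of $S\subset\mathbb R^d$, and the Fourier transform of an integrable $f:\mathbb R^d\to\mathbb R$ is $\hat f(\boldsymbol\omega)=\int_{\mathbb R^d}e^{-i\boldsymbol\omega\cdot\mathbf x}f(\mathbf x)\,d\mathbf x$. *)

theory Defs
  imports "HOL-Probability.Probability"
begin

definition L_norm :: "ereal \<Rightarrow> real ^ 'd \<Rightarrow> real" where
  "L_norm \<sigma> x =
     (if \<sigma> = \<infinity> then Max (range (\<lambda>k. \<bar>x $ k\<bar>))
      else (\<Sum>k\<in>UNIV. \<bar>x $ k\<bar> powr real_of_ereal \<sigma>) powr (1 / real_of_ereal \<sigma>))"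

definition L_ball :: "ereal \<Rightarrow> real \<Rightarrow> (real ^ 'd) set" where
  "L_ball \<sigma> r = {x. L_norm \<sigma> x \<le> r}"

definition lattice_vec :: "int ^ 'd \<Rightarrow> real ^ 'd" where
  "lattice_vec m = (\<chi> k. of_int (m $ k))"

text \<open>Points of the torus are represented by arbitrary representatives in \<open>\<real>\<^sup>d\<close>.
  The infimum is a minimum, since only finitely many lattice translates of a point
  lie in any given ball.\<close>

definition torus_dist :: "ereal \<Rightarrow> real ^ 'd \<Rightarrow> real ^ 'd \<Rightarrow> real" where
  "torus_dist \<sigma> x y = (INF u. L_norm \<sigma> (x - y - lattice_vec u))"

definition torus_uniform :: "(real ^ 'd) measure" where
  "torus_uniform = uniform_measure lborel (cbox 0 1)"

definition geometric_graph_edges ::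
    "ereal \<Rightarrow> real \<Rightarrow> nat \<Rightarrow> (nat \<Rightarrow> real ^ 'd) \<Rightarrow> nat set set" where
  "geometric_graph_edges \<sigma> r n x =
     {{i, j} | i j. i \<in> {1..n} \<and> j \<in> {1..n} \<and> i \<noteq> j \<and> torus_dist \<sigma> (x i) (x j) \<le> r}"

definition edge_probability :: "('d :: finite) itself \<Rightarrow> ereal \<Rightarrow> real \<Rightarrow> real" where
  "edge_probability _ \<sigma> r =
     measure (torus_uniform \<Otimes>\<^sub>M torus_uniform)
       {(x :: real ^ 'd, y). torus_dist \<sigma> x y \<le> r}"

definition labeled_cycle :: "'v set \<Rightarrow> nat \<Rightarrow> 'v list \<Rightarrow> bool" where
  "labeled_cycle V q ys \<longleftrightarrow> length ys = q \<and> distinct ys \<and> set ys \<subseteq> V"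

definition cycle_present :: "'v set set \<Rightarrow> 'v list \<Rightarrow> bool" where
  "cycle_present E ys \<longleftrightarrow>
     (\<forall>i < length ys - 1. {ys ! i, ys ! Suc i} \<in> E) \<and> {last ys, hd ys} \<in> E"

definition cycle_probability :: "'a measure \<Rightarrow> ('a \<Rightarrow> 'v set set) \<Rightarrow> 'v list \<Rightarrow> real" where
  "cycle_probability M G ys = measure M {\<omega> \<in> space M. cycle_present (G \<omega>) ys}"

definition fourier_transform :: "(real ^ 'd \<Rightarrow> real) \<Rightarrow> real ^ 'd \<Rightarrow> complex" where
  "fourier_transform f w =
     (LINT x|lebesgue. exp (- \<i> * complex_of_real (w \<bullet> x)) * complex_of_real (f x))"

end

theory Submission
  imports Defs
begin

text \<open>Let \<open>f\<close> be the indicator of the ball of radius \<open>r\<close> on the torus. Integrating out the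
  vertices of the cycle one by one shows that the cycle probability is the value at \<open>0\<close> of the
  \<open>q\<close>-fold periodic convolution power of \<open>f\<close>, whose Fourier coefficients are the \<open>q\<close>-th powers
  of those of \<open>f\<close>. Since \<open>r \<le> 1/2\<close>, the latter are the values of the Fourier transform of
  the indicator of the ball in \<open>\<real>\<^sup>d\<close> on the dual lattice. By Bessel's inequality the
  Fourier series of the convolution power converges absolutely; as the sphere is a null set, the
  convolution power is continuous at \<open>0\<close>. The two functions have the same Fourier coefficients, so they
  agree at \<open>0\<close>: test their difference against powers of the trigonometric polynomial
  \<open>\<Prod>\<^sub>k (1 + cos (2 \<pi> x\<^sub>k)) / 2\<close>, which concentrate at the lattice points.\<close>

subsection \<open>The norms\<close>

lemma L_norm_finite:
  "L_norm (ereal p) x = (\<Sum>k\<in>UNIV. \<bar>x $ k\<bar> powr p) powr (1 / p)"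
  by (simp add: L_norm_def)

lemma L_norm_infinity: "L_norm \<infinity> x = Max (range (\<lambda>k. \<bar>x $ k\<bar>))"
  by (simp add: L_norm_def)

lemma exponent_cases:
  fixes \<sigma> :: ereal
  assumes "1 \<le> \<sigma>"
  obtains (finite) p where "\<sigma> = ereal p" "1 \<le> p" | (infinite) "\<sigma> = \<infinity>"
  using assms by (cases \<sigma>) auto

text \<open>Both forms of the norm are nondecreasing in every \<open>\<bar>x $ k\<bar>\<close>. This
  is what singles out the zero translate as the nearest one for points of the centered cube.\<close>

lemma L_norm_mono:
  fixes x y :: "real ^ 'd"
  assumes "1 \<le> \<sigma>" and le: "\<And>k. \<bar>x $ k\<bar> \<le> \<bar>y $ k\<bar>"
  shows "L_norm \<sigma> x \<le> L_norm \<sigma> y"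
  using assms(1)
proof (cases rule: exponent_cases)
  case (finite p)
  have "(\<Sum>k\<in>UNIV. \<bar>x $ k\<bar> powr p) \<le> (\<Sum>k\<in>UNIV. \<bar>y $ k\<bar> powr p)"
    using finite le by (intro sum_mono powr_mono2) auto
  then show ?thesis
    using finite by (auto simp: L_norm_finite intro!: powr_mono2 sum_nonneg)
next
  case infinite
  have "\<bar>x $ k\<bar> \<le> Max (range (\<lambda>k. \<bar>y $ k\<bar>))" for k
    by (rule order_trans[OF le[of k]]) (auto intro!: Max_ge)
  with infinite show ?thesis
    by (auto simp: L_norm_infinity)
qed

text \<open>A single term is at most the whole sum or maximum. For radius at most 1/2 this places
  the ball inside the centered cube.\<close>

lemma component_le_L_norm:
  fixes x :: "real ^ 'd"
  assumes "1 \<le> \<sigma>"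
  shows "\<bar>x $ k\<bar> \<le> L_norm \<sigma> x"
  using assms
proof (cases rule: exponent_cases)
  case (finite p)
  have "\<bar>x $ k\<bar> = (\<bar>x $ k\<bar> powr p) powr (1 / p)"
    using finite by (simp add: powr_powr)
  also have "\<dots> \<le> (\<Sum>k\<in>UNIV. \<bar>x $ k\<bar> powr p) powr (1 / p)"
    using finite by (intro powr_mono2 member_le_sum) auto
  finally show ?thesis
    by (simp add: finite L_norm_finite)
next
  case infinite
  then show ?thesis
    by (auto simp: L_norm_infinity intro!: Max_ge)
qed

lemma L_norm_nonneg: "1 \<le> \<sigma> \<Longrightarrow> 0 \<le> L_norm \<sigma> x"
  using component_le_L_norm[of \<sigma> x undefined] by linarith

lemma L_norm_minus: "L_norm \<sigma> (- x) = L_norm \<sigma> x"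
  by (simp add: L_norm_def)

lemma L_norm_scaleR:
  fixes x :: "real ^ 'd"
  assumes "1 \<le> \<sigma>" "0 \<le> c"
  shows "L_norm \<sigma> (c *\<^sub>R x) = c * L_norm \<sigma> x"
  using assms(1)
proof (cases rule: exponent_cases)
  case (finite p)
  have "(\<Sum>k\<in>UNIV. \<bar>(c *\<^sub>R x) $ k\<bar> powr p) = c powr p * (\<Sum>k\<in>UNIV. \<bar>x $ k\<bar> powr p)"
    using assms by (simp add: abs_mult powr_mult sum_distrib_left)
  then show ?thesis
    using finite assms by (simp add: L_norm_finite powr_mult powr_powr sum_nonneg)
next
  case infinite
  have "c * Max (range (\<lambda>k. \<bar>x $ k\<bar>)) = Max ((\<lambda>t. c * t) ` range (\<lambda>k. \<bar>x $ k\<bar>))"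
    using assms by (intro mono_Max_commute) (auto intro!: monoI mult_left_mono)
  with infinite show ?thesis
    using assms by (simp add: L_norm_infinity abs_mult image_image)
qed

text \<open>Induction over the index set, adding one binary maximum at a time; it serves the case
  \<sigma> = \<infinity>.\<close>

lemma continuous_on_Max_image:
  fixes g :: "'i \<Rightarrow> 'a::topological_space \<Rightarrow> real"
  assumes "finite I" "I \<noteq> {}" "\<And>i. i \<in> I \<Longrightarrow> continuous_on S (g i)"
  shows "continuous_on S (\<lambda>x. Max ((\<lambda>i. g i x) ` I))"
  using assms
proof (induction I rule: finite_ne_induct)
  case (insert i F)
  then have "continuous_on S (\<lambda>x. max (g i x) (Max ((\<lambda>i. g i x) ` F)))"
    by (intro continuous_on_max) auto
  with insert show ?case
    by simp
qed auto

lemma continuous_on_L_norm: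
  assumes "1 \<le> \<sigma>"
  shows "continuous_on S (L_norm \<sigma> :: real ^ 'd \<Rightarrow> real)"
  using assms
proof (cases rule: exponent_cases)
  case (finite p)
  have "continuous_on S (\<lambda>x :: real ^ 'd. (\<Sum>k\<in>UNIV. \<bar>x $ k\<bar> powr p) powr (1 / p))"
    using finite by (intro continuous_on_powr' continuous_intros) (auto intro!: sum_nonneg)
  then show ?thesis
    by (simp add: finite L_norm_finite[abs_def])
next
  case infinite
  then show ?thesis
    unfolding infinite L_norm_infinity[abs_def]
    by (intro continuous_on_Max_image continuous_intros) auto
qed

lemma borel_measurable_L_norm:
  "1 \<le> \<sigma> \<Longrightarrow> (L_norm \<sigma> :: real ^ 'd \<Rightarrow> real) \<in> borel_measurable borel"
  by (intro borel_measurable_continuous_onI continuous_on_L_norm)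

text \<open>By homogeneity every ray from the origin meets the sphere at most once, and a closed set
  with this property is a Lebesgue null set.\<close>

lemma negligible_L_sphere:
  fixes r :: real
  assumes "1 \<le> \<sigma>" "0 < r"
  shows "negligible {x :: real ^ 'd. L_norm \<sigma> x = r}"
proof (rule starlike_negligible[where a = 0])
  show "closed {x :: real ^ 'd. L_norm \<sigma> x = r}"
    using assms by (intro closed_Collect_eq continuous_on_L_norm continuous_intros)
  show "c = 1" if "0 + c *\<^sub>R x \<in> {x. L_norm \<sigma> x = r}" "0 \<le> c"
    "0 + x \<in> {x. L_norm \<sigma> x = r}" for c and x :: "real ^ 'd"
    using that assms by (simp add: L_norm_scaleR)
qed

subsection \<open>Integration over the torus\<close>

lemma lattice_vec_nth [simp]: "lattice_vec m $ k = of_int (m $ k)"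
  by (simp add: lattice_vec_def)

lemma lattice_vec_add: "lattice_vec (m + n) = lattice_vec m + lattice_vec n"
  and lattice_vec_minus: "lattice_vec (- m) = - lattice_vec m"
  and lattice_vec_0 [simp]: "lattice_vec 0 = 0"
  by (simp_all add: vec_eq_iff)

text \<open>Functions on the torus are represented by their periodic lifts to the whole
  space.\<close>

definition lattice_periodic :: "(real ^ 'd \<Rightarrow> 'b) \<Rightarrow> bool" where
  "lattice_periodic f \<longleftrightarrow> (\<forall>x u. f (x + lattice_vec u) = f x)"

lemma lattice_periodicD: "lattice_periodic f \<Longrightarrow> f (x + lattice_vec u) = f x"
  by (simp add: lattice_periodic_def)

text \<open>Half-open, so that every point has exactly one lattice translate in it; the closed cube
  behind \<open>torus_uniform\<close> differs from it by a null set only.\<close>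

definition unit_cell :: "(real ^ 'd) set" where
  "unit_cell = {x. \<forall>k. 0 \<le> x $ k \<and> x $ k < 1}"

text \<open>The representative in \<open>unit_cell\<close> of the torus point given by
  \<open>x\<close>.\<close>

definition vec_frac :: "real ^ 'd \<Rightarrow> real ^ 'd" where
  "vec_frac x = (\<chi> k. frac (x $ k))"

lemma measurable_unit_cell [measurable]: "(unit_cell :: (real ^ 'd) set) \<in> sets borel"
  unfolding unit_cell_def by measurable

lemma vec_frac_eq: "vec_frac x = x + lattice_vec (\<chi> k. - \<lfloor>x $ k\<rfloor>)"
  by (simp add: vec_eq_iff vec_frac_def frac_def)

lemma lattice_periodic_vec_frac: "lattice_periodic f \<Longrightarrow> f (vec_frac x) = f x"
  by (simp add: vec_frac_eq lattice_periodicD)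

lemma vec_frac_periodic: "vec_frac (x + lattice_vec u) = vec_frac x"
  by (simp add: vec_frac_def vec_eq_iff frac_def)

lemma vec_frac_unit_cell: "x \<in> unit_cell \<Longrightarrow> vec_frac x = x"
  by (auto simp: unit_cell_def vec_eq_iff vec_frac_def frac_eq)

lemma borel_measurable_vec_frac [measurable]:
  "(vec_frac :: real ^ 'd \<Rightarrow> real ^ 'd) \<in> borel_measurable borel"
proof (rule borel_measurable_euclidean_space[THEN iffD2], rule ballI)
  fix i :: "real ^ 'd" assume "i \<in> Basis"
  then obtain k where "i = axis k 1"
    by (auto simp: Basis_vec_def)
  then have "(\<lambda>x. vec_frac x \<bullet> i) = (\<lambda>x. frac (x $ k))"
    by (simp add: vec_frac_def inner_axis fun_eq_iff)
  then show "(\<lambda>x. vec_frac x \<bullet> i) \<in> borel_measurable borel"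
    by (simp add: frac_def)
qed

lemma unit_cell_translate_iff:
  "x + lattice_vec u \<in> unit_cell \<longleftrightarrow> u = (\<chi> k. - \<lfloor>x $ k\<rfloor>)"
proof -
  have "0 \<le> x $ k + of_int (u $ k) \<and> x $ k + of_int (u $ k) < 1 \<longleftrightarrow> u $ k = - \<lfloor>x $ k\<rfloor>" for k
    by linarith
  then show ?thesis
    by (simp add: unit_cell_def vec_eq_iff)
qed

text \<open>The lattice is countable, and infinite because it contains the constant vectors. The
  enumeration turns sums over the lattice into ordinary series.\<close>

lemma bij_enum_lattice: "bij (from_nat_into UNIV :: nat \<Rightarrow> int ^ 'd)"
proof -
  have "inj (vec :: int \<Rightarrow> int ^ 'd)"
    by (auto simp: inj_on_def vec_eq_iff)
  then have "infinite (UNIV :: (int ^ 'd) set)"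
    using infinite_UNIV_int finite_UNIV_inj_surj finite_subset[OF subset_UNIV]
    by (metis finite_imageD)
  then show ?thesis
    using bij_betw_from_nat_into[of "UNIV :: (int ^ 'd) set"] by simp
qed

text \<open>The lattice translates of the cell tile the space: the only nonzero term is the one
  whose shift is minus the coordinatewise floor. Multiplying an integrand by this sum cuts it into
  pieces along the lattice.\<close>

lemma suminf_indicator_unit_cell:
  fixes b :: "nat \<Rightarrow> int ^ 'd"
  assumes "bij b"
  shows "(\<Sum>n. indicator unit_cell (x + lattice_vec (b n)) :: ennreal) = 1"
proof -
  obtain i where i: "b i = (\<chi> k. - \<lfloor>x $ k\<rfloor>)"
    using assms by (metis bij_pointE)
  have "b n = b i \<longleftrightarrow> n = i" for n
    using assms by (simp add: bij_is_inj inj_eq)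
  then have "(\<lambda>n. indicator unit_cell (x + lattice_vec (b n)) :: ennreal) =
    (\<lambda>n. if n = i then 1 else 0)"
    by (auto simp: indicator_def unit_cell_translate_iff fun_eq_iff simp flip: i)
  then show ?thesis
    using sums_single[of i "\<lambda>_. 1 :: ennreal"] by (simp add: sums_iff)
qed

lemma nn_integral_lborel_translate:
  fixes a :: "'a::euclidean_space"
  assumes [measurable]: "g \<in> borel_measurable borel"
  shows "(\<integral>\<^sup>+ x. g (x + a) \<partial>lborel) = (\<integral>\<^sup>+ x. g x \<partial>lborel)"
proof -
  have "(\<integral>\<^sup>+ x. g x \<partial>lborel) = (\<integral>\<^sup>+ x. g x \<partial>distr lborel borel ((+) a))"
    by (simp add: lborel_distr_plus)
  also have "\<dots> = (\<integral>\<^sup>+ x. g (x + a) \<partial>lborel)"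
    by (subst nn_integral_distr) (auto simp: add.commute)
  finally show ?thesis ..
qed

text \<open>Cut the translated cell along the lattice and move the pieces back.\<close>

lemma nn_integral_unit_cell_translate:
  fixes g :: "real ^ 'd \<Rightarrow> ennreal"
  assumes [measurable]: "g \<in> borel_measurable borel" and "lattice_periodic g"
  shows "(\<integral>\<^sup>+ x. g (x + a) * indicator unit_cell x \<partial>lborel) =
    (\<integral>\<^sup>+ x. g x * indicator unit_cell x \<partial>lborel)"
proof -
  let ?D = "unit_cell :: (real ^ 'd) set"
  define b :: "nat \<Rightarrow> int ^ 'd" where "b = from_nat_into UNIV"
  have b: "bij b"
    by (simp add: b_def bij_enum_lattice)
  \<comment> \<open>The first cut runs over the negated enumeration. Substituting
    \<open>x + lattice_vec (b n)\<close> then turns the extra indicator into that of the cell itself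
    and leaves a sum over \<open>b\<close>, which the tiling collapses again.\<close>
  have b': "bij (\<lambda>n. - b n)"
    using bij_comp[OF b bij_uminus] by (simp add: comp_def)
  have "(\<integral>\<^sup>+ x. g (x + a) * indicator ?D x \<partial>lborel) =
      (\<integral>\<^sup>+ x. g x * indicator ?D (x - a) \<partial>lborel)"
    using nn_integral_lborel_translate[of "\<lambda>x. g x * indicator ?D (x - a)" a] by simp
  also have "\<dots> = (\<integral>\<^sup>+ x. (\<Sum>n. g x * indicator ?D (x - a) *
      indicator ?D (x + lattice_vec (- b n))) \<partial>lborel)"
    using suminf_indicator_unit_cell[OF b'] by (simp add: ennreal_suminf_cmult)
  also have "\<dots> = (\<Sum>n. \<integral>\<^sup>+ x. g x * indicator ?D (x - a) *
      indicator ?D (x + lattice_vec (- b n)) \<partial>lborel)"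
    by (intro nn_integral_suminf) measurable
  also have "\<dots> = (\<Sum>n. \<integral>\<^sup>+ x. g x * indicator ?D x *
      indicator ?D (x - a + lattice_vec (b n)) \<partial>lborel)"
  proof (intro suminf_cong)
    fix n
    have "(\<integral>\<^sup>+ x. g x * indicator ?D (x - a) *
        indicator ?D (x + lattice_vec (- b n)) \<partial>lborel) =
      (\<integral>\<^sup>+ x. g (x + lattice_vec (b n)) * indicator ?D (x + lattice_vec (b n) - a) *
        indicator ?D (x + lattice_vec (b n) + lattice_vec (- b n)) \<partial>lborel)"
      by (rule nn_integral_lborel_translate[symmetric]) measurable
    then show "(\<integral>\<^sup>+ x. g x * indicator ?D (x - a) *
        indicator ?D (x + lattice_vec (- b n)) \<partial>lborel) = (\<integral>\<^sup>+ x. g x * indicator ?D x *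
      indicator ?D (x - a + lattice_vec (b n)) \<partial>lborel)"
      using assms by (simp add: lattice_periodicD lattice_vec_minus algebra_simps)
  qed
  also have "\<dots> = (\<integral>\<^sup>+ x. (\<Sum>n. g x * indicator ?D x *
      indicator ?D (x - a + lattice_vec (b n))) \<partial>lborel)"
    by (intro nn_integral_suminf[symmetric]) measurable
  also have "\<dots> = (\<integral>\<^sup>+ x. g x * indicator ?D x \<partial>lborel)"
    using suminf_indicator_unit_cell[OF b] by (simp add: ennreal_suminf_cmult)
  finally show ?thesis .
qed

section \<open>The uniform distribution on the torus and its translation invariance\<close>

lemma emeasure_unit_cube: "emeasure lborel (cbox 0 1 :: (real ^ 'd) set) = 1"
proof -
  have "(0 :: real ^ 'd) \<in> cbox 0 1"
    by (simp add: mem_box_cart)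
  then have "measure lborel (cbox 0 1 :: (real ^ 'd) set) = 1"
    using content_cbox_cart[of "0 :: real ^ 'd" 1] by auto
  then show ?thesis
    using emeasure_eq_ennreal_measure[of lborel "cbox 0 1 :: (real ^ 'd) set"]
      emeasure_lborel_cbox_finite[of "0 :: real ^ 'd" 1] by (simp add: less_top)
qed

lemma sets_torus_uniform [measurable_cong, simp]: "sets torus_uniform = sets borel"
  by (simp add: torus_uniform_def)

lemma space_torus_uniform [simp]: "space torus_uniform = UNIV"
  by (simp add: torus_uniform_def)

lemma prob_space_torus_uniform: "prob_space (torus_uniform :: (real ^ 'd) measure)"
  unfolding torus_uniform_def by (intro prob_space_uniform_measure) (simp_all add: emeasure_unit_cube)

interpretation torus: prob_space "torus_uniform :: (real ^ 'd) measure"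
  by (rule prob_space_torus_uniform)

lemma measure_torus_UNIV [simp]: "measure (torus_uniform :: (real ^ 'd) measure) UNIV = 1"
  using torus.prob_space[where 'd = 'd] by simp

lemma integrable_torus_bounded:
  fixes g :: "real ^ 'd \<Rightarrow> 'b::{banach,second_countable_topology}"
  assumes "g \<in> borel_measurable borel" "\<And>x. norm (g x) \<le> B"
  shows "integrable torus_uniform g"
  by (rule torus.integrable_const_bound[of _ B]) (use assms in auto)

lemma AE_lborel_not_in_negligible:
  assumes "negligible S"
  shows "AE x in lborel. x \<notin> S"
  using assms AE_not_in[of S lebesgue]
  by (simp add: negligible_iff_null_sets AE_completion_iff)

text \<open>The half-open cell lies between the open and the closed cube, so the difference is
  contained in the frontier of the cube, a null set.\<close>

lemma AE_unit_cell: "AE x in lborel. x \<in> cbox 0 1 \<longleftrightarrow> x \<in> (unit_cell :: (real ^ 'd) set)"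
  using AE_lborel_not_in_negligible[OF negligible_frontier_interval[of 0 "1 :: real ^ 'd"]]
proof eventually_elim
  case (elim x)
  have "x \<in> box 0 1 \<Longrightarrow> x \<in> unit_cell" "x \<in> unit_cell \<Longrightarrow> x \<in> cbox 0 1"
    by (auto simp: mem_box_cart unit_cell_def less_imp_le)
  with elim show ?case
    by blast
qed

lemma nn_integral_torus_uniform:
  assumes [measurable]: "g \<in> borel_measurable borel"
  shows "(\<integral>\<^sup>+ x. g x \<partial>torus_uniform) =
    (\<integral>\<^sup>+ x. g x * indicator (unit_cell :: (real ^ 'd) set) x \<partial>lborel)"
proof -
  have "(\<integral>\<^sup>+ x. g x \<partial>torus_uniform) =
      (\<integral>\<^sup>+ x. g x * indicator (cbox 0 1 :: (real ^ 'd) set) x \<partial>lborel)"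
    unfolding torus_uniform_def
    by (subst nn_integral_uniform_measure) (simp_all add: emeasure_unit_cube divide_ennreal_def)
  also have "\<dots> = (\<integral>\<^sup>+ x. g x * indicator unit_cell x \<partial>lborel)"
    by (rule nn_integral_cong_AE) (use AE_unit_cell in eventually_elim, auto simp: indicator_def)
  finally show ?thesis .
qed

text \<open>The indicator of \<open>A\<close> composed with \<open>vec_frac\<close> is lattice
  periodic, so invariance of cell integrals applies to it. Stating invariance for the measure makes
  it available for vector-valued integrals too.\<close>

lemma distr_torus_translate:
  fixes a :: "real ^ 'd"
  shows "distr torus_uniform borel (\<lambda>x. vec_frac (x + a)) = torus_uniform"
proof (rule measure_eqI)
  fix A :: "(real ^ 'd) set"
  assume "A \<in> sets (distr torus_uniform borel (\<lambda>x. vec_frac (x + a)))"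
  then have A [measurable]: "A \<in> sets borel"
    by simp
  let ?g = "\<lambda>x. indicator A (vec_frac x) :: ennreal"
  have "emeasure (distr torus_uniform borel (\<lambda>x. vec_frac (x + a))) A =
      (\<integral>\<^sup>+ x. indicator A x \<partial>distr torus_uniform borel (\<lambda>x. vec_frac (x + a)))"
    by simp
  also have "\<dots> = (\<integral>\<^sup>+ x. ?g (x + a) \<partial>torus_uniform)"
    by (subst nn_integral_distr) auto
  also have "\<dots> = (\<integral>\<^sup>+ x. ?g (x + a) * indicator unit_cell x \<partial>lborel)"
    by (intro nn_integral_torus_uniform) measurable
  also have "\<dots> = (\<integral>\<^sup>+ x. ?g x * indicator unit_cell x \<partial>lborel)"
    by (intro nn_integral_unit_cell_translate)
      (auto simp: lattice_periodic_def vec_frac_periodic)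
  also have "\<dots> = (\<integral>\<^sup>+ x. indicator A x * indicator unit_cell x \<partial>lborel)"
    by (intro nn_integral_cong) (auto simp: indicator_def vec_frac_unit_cell)
  also have "\<dots> = (\<integral>\<^sup>+ x. indicator A x \<partial>torus_uniform)"
    by (intro nn_integral_torus_uniform[symmetric]) measurable
  finally show "emeasure (distr torus_uniform borel (\<lambda>x. vec_frac (x + a))) A =
      emeasure torus_uniform A"
    by simp
qed simp

lemma integral_torus_translate:
  fixes g :: "real ^ 'd \<Rightarrow> 'b::{banach,second_countable_topology}"
  assumes [measurable]: "g \<in> borel_measurable borel" and "lattice_periodic g"
  shows "(\<integral>x. g (x + a) \<partial>torus_uniform) = (\<integral>x. g x \<partial>torus_uniform)"
proof -
  have "(\<integral>x. g x \<partial>torus_uniform) =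
      (\<integral>x. g x \<partial>distr torus_uniform borel (\<lambda>x. vec_frac (x + a)))"
    by (simp add: distr_torus_translate)
  also have "\<dots> = (\<integral>x. g (x + a) \<partial>torus_uniform)"
    using assms by (subst integral_distr) (auto simp: lattice_periodic_vec_frac)
  finally show ?thesis ..
qed

lemma integral_torus_uniform:
  fixes g :: "real ^ 'd \<Rightarrow> 'b::{banach,second_countable_topology}"
  assumes [measurable]: "g \<in> borel_measurable borel"
  shows "(\<integral>x. g x \<partial>torus_uniform) = (\<integral>x. indicat_real (cbox 0 1) x *\<^sub>R g x \<partial>lborel)"
proof -
  let ?D = "density lborel (\<lambda>x :: real ^ 'd. ennreal (indicator (cbox 0 1) x))"
  have "torus_uniform = ?D"
    unfolding torus_uniform_def uniform_measure_def
    by (intro density_cong) (auto simp: emeasure_unit_cube indicator_def divide_ennreal_def)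
  then have "integral\<^sup>L torus_uniform g = integral\<^sup>L ?D g"
    by (rule arg_cong)
  then show ?thesis
    by (subst (asm) integral_density) auto
qed

text \<open>A second fundamental domain, up to its boundary. On it the torus distance to 0 is the
  norm, and for \<open>r \<le> 1/2\<close> it contains the whole ball.\<close>

abbreviation centered_cube :: "(real ^ 'd) set" where
  "centered_cube \<equiv> cbox (- vec (1/2)) (vec (1/2))"

lemma mem_centered_cube: "x \<in> centered_cube \<longleftrightarrow> (\<forall>k. \<bar>x $ k\<bar> \<le> 1/2)"
proof -
  have "- (1/2) \<le> x $ k \<and> x $ k \<le> 1/2 \<longleftrightarrow> \<bar>x $ k\<bar> \<le> 1/2" for k
    by linarith
  then show ?thesis
    by (simp add: mem_box_cart)
qed

text \<open>Translation by half a period in every coordinate carries the unit cube to the centered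
  one and does not change the torus integral of a periodic function.\<close>

lemma integral_torus_centered:
  fixes g :: "real ^ 'd \<Rightarrow> 'b::{banach,second_countable_topology}"
  assumes [measurable]: "g \<in> borel_measurable borel" and "lattice_periodic g"
  shows "(\<integral>x. g x \<partial>torus_uniform) = (\<integral>x. indicat_real centered_cube x *\<^sub>R g x \<partial>lborel)"
proof -
  let ?h = "vec (1/2) :: real ^ 'd"
  have "(\<integral>x. g x \<partial>torus_uniform) = (\<integral>x. g (x + - ?h) \<partial>torus_uniform)"
    using assms by (intro integral_torus_translate[symmetric])
  also have "\<dots> = (\<integral>x. indicat_real (cbox 0 1) x *\<^sub>R g (x + - ?h) \<partial>lborel)"
    by (intro integral_torus_uniform) measurable
  also have "\<dots> = (\<integral>x. indicat_real (cbox 0 1) x *\<^sub>R g (x + - ?h) \<partial>distr lborel borel ((+) ?h))"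
    by (simp add: lborel_distr_plus)
  also have "\<dots> = (\<integral>x. indicat_real (cbox 0 1) (?h + x) *\<^sub>R g (?h + x + - ?h) \<partial>lborel)"
    by (intro integral_distr) measurable
  also have "\<dots> = (\<integral>x. indicat_real centered_cube x *\<^sub>R g x \<partial>lborel)"
  proof (intro Bochner_Integration.integral_cong refl)
    fix x :: "real ^ 'd"
    have "?h + x \<in> cbox 0 1 \<longleftrightarrow> x \<in> centered_cube"
      by (simp add: mem_box_cart) (smt (verit) field_sum_of_halves)
    then show "indicat_real (cbox 0 1) (?h + x) *\<^sub>R g (?h + x + - ?h) =
        indicat_real centered_cube x *\<^sub>R g x"
      by (simp add: indicator_def)
  qed
  finally show ?thesis .
qed

subsection \<open>Characters and Fourier coefficients\<close>

definition torus_char :: "int ^ 'd \<Rightarrow> real ^ 'd \<Rightarrow> complex" where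
  "torus_char m x = cis (2 * pi * (lattice_vec m \<bullet> x))"

lemma norm_torus_char [simp]: "norm (torus_char m x) = 1"
  by (simp add: torus_char_def)

lemma continuous_on_torus_char: "continuous_on S (torus_char m)"
  unfolding torus_char_def by (intro continuous_intros)

lemma borel_measurable_torus_char [measurable]: "torus_char m \<in> borel_measurable borel"
  by (intro borel_measurable_continuous_onI continuous_on_torus_char)

lemma torus_char_add: "torus_char m (x + y) = torus_char m x * torus_char m y"
  by (simp add: torus_char_def inner_add_right distrib_left cis_mult)

lemma torus_char_add_index: "torus_char (m + n) x = torus_char m x * torus_char n x"
  by (simp add: torus_char_def lattice_vec_add inner_add_left distrib_left cis_mult)

lemma torus_char_0 [simp]: "torus_char m 0 = 1"
  and torus_char_0_index [simp]: "torus_char 0 x = 1"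
  by (simp_all add: torus_char_def)

lemma cnj_torus_char: "cnj (torus_char m x) = torus_char (- m) x"
  by (simp add: torus_char_def lattice_vec_minus cis_cnj)

lemma torus_char_lattice_vec: "torus_char m (lattice_vec u) = 1"
proof -
  have "lattice_vec m \<bullet> lattice_vec u = of_int (\<Sum>k\<in>UNIV. m $ k * u $ k)"
    by (simp add: inner_vec_def)
  then show ?thesis
    unfolding torus_char_def by (metis cis_multiple_2pi Ints_of_int)
qed

lemma lattice_periodic_torus_char: "lattice_periodic (torus_char m)"
  by (simp add: lattice_periodic_def torus_char_add torus_char_lattice_vec)

text \<open>Translating by a point where the character is \<open>-1\<close> changes the sign of its integral.\<close>

lemma integral_torus_char:
  "(\<integral>x. torus_char m x \<partial>torus_uniform) = (if m = (0 :: int ^ 'd) then 1 else 0)"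
proof (cases "m = 0")
  case True
  then show ?thesis
    by simp
next
  case False
  then obtain k where k: "m $ k \<noteq> 0"
    by (auto simp: vec_eq_iff)
  \<comment> \<open>Half a period along a coordinate of nonzero frequency: the phase there is
    \<open>pi\<close>.\<close>
  let ?a = "axis k (1 / (2 * of_int (m $ k))) :: real ^ 'd"
  have a: "torus_char m ?a = - 1"
    using k by (simp add: torus_char_def inner_axis)
  have "(\<integral>x. torus_char m x \<partial>torus_uniform) = (\<integral>x. torus_char m (x + ?a) \<partial>torus_uniform)"
    by (intro integral_torus_translate[symmetric] lattice_periodic_torus_char) measurable
  also have "\<dots> = - (\<integral>x. torus_char m x \<partial>torus_uniform)"
    by (simp add: torus_char_add a)
  finally show ?thesis
    using False by simp
qed

section \<open>Fourier coefficients and Bessel's inequality\<close>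

definition torus_coeff :: "(real ^ 'd \<Rightarrow> complex) \<Rightarrow> int ^ 'd \<Rightarrow> complex" where
  "torus_coeff g m = (\<integral>x. g x * torus_char (- m) x \<partial>torus_uniform)"

lemma integrable_torus_coeff:
  assumes [measurable]: "g \<in> borel_measurable borel" and "\<And>x. norm (g x) \<le> B"
  shows "integrable torus_uniform (\<lambda>x. g x * torus_char m x)"
  using assms by (intro integrable_torus_bounded[of _ B]) (auto simp: norm_mult)

text \<open>Let \<open>p\<close> be the Fourier partial sum over \<open>S\<close>. Expanding the
  integral of the square of \<open>norm (g x - p x)\<close>, which is nonnegative, the cross term
  and the square of \<open>p\<close> both reduce to the sum of squared coefficients. Hence that sum
  is at most the integral of the square of \<open>norm (g x)\<close>, which is at most 1.\<close>

lemma Bessel_torus: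
  fixes g :: "real ^ 'd \<Rightarrow> complex"
  assumes [measurable]: "g \<in> borel_measurable borel" and bd: "\<And>x. norm (g x) \<le> 1"
    and "finite S"
  shows "(\<Sum>m\<in>S. (norm (torus_coeff g m))\<^sup>2) \<le> 1"
proof -
  define c where "c = torus_coeff g"
  define p where "p x = (\<Sum>m\<in>S. c m * torus_char m x)" for x
  let ?s = "\<Sum>m\<in>S. (norm (c m))\<^sup>2"
  have p [measurable]: "p \<in> borel_measurable borel"
    unfolding p_def by measurable
  have p_bound: "norm (p x) \<le> (\<Sum>m\<in>S. norm (c m))" for x
    unfolding p_def by (rule order_trans[OF norm_sum]) (simp add: norm_mult)
  have cnj_p: "cnj (p x) = (\<Sum>m\<in>S. cnj (c m) * torus_char (- m) x)" for x
    by (simp add: p_def cnj_torus_char)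
  \<comment> \<open>Here and below \<open>h\<close> is \<open>g\<close> or \<open>p\<close>, so that
    one computation yields both the cross term and the square term.\<close>
  have int: "integrable torus_uniform (\<lambda>x. h x * torus_char m x)" if "h = g \<or> h = p" for h m
    using that bd p_bound
      integrable_torus_coeff[of g 1 m] integrable_torus_coeff[of p "\<Sum>m\<in>S. norm (c m)" m] by auto
  have ip: "(\<integral>x. h x * cnj (p x) \<partial>torus_uniform) = (\<Sum>m\<in>S. cnj (c m) * torus_coeff h m)"
    if "h = g \<or> h = p" for h
  proof -
    have "(\<integral>x. h x * cnj (p x) \<partial>torus_uniform) =
        (\<integral>x. (\<Sum>m\<in>S. cnj (c m) * (h x * torus_char (- m) x)) \<partial>torus_uniform)"
      by (simp add: cnj_p sum_distrib_left mult_ac)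
    also have "\<dots> = (\<Sum>m\<in>S. cnj (c m) * torus_coeff h m)"
      using int[OF that] by (simp add: torus_coeff_def Bochner_Integration.integral_sum)
    finally show ?thesis .
  qed
  \<comment> \<open>Orthogonality of the characters: the partial sum has the prescribed coefficients
    on \<open>S\<close>.\<close>
  have coeff_p: "torus_coeff p m = c m" if "m \<in> S" for m
  proof -
    have "torus_coeff p m = (\<integral>x. (\<Sum>n\<in>S. c n * torus_char (n - m) x) \<partial>torus_uniform)"
      by (simp add: torus_coeff_def p_def sum_distrib_right mult.assoc
          flip: torus_char_add_index)
    also have "\<dots> = (\<Sum>n\<in>S. c n * (if n = m then 1 else 0))"
      by (subst Bochner_Integration.integral_sum)
        (auto simp: integral_torus_char norm_mult intro!: sum.cong integrable_torus_bounded)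
    also have "\<dots> = c m"
      using that \<open>finite S\<close> by (simp add: if_distrib[of "(*) _"] cong: if_cong)
    finally show ?thesis .
  qed
  have *: "(\<Sum>m\<in>S. cnj (c m) * c m) = of_real ?s"
    by (simp add: mult.commute complex_norm_square[symmetric])
  have gp: "(\<integral>x. g x * cnj (p x) \<partial>torus_uniform) = of_real ?s"
    using ip[of g] * by (simp add: c_def)
  have pp: "(\<integral>x. p x * cnj (p x) \<partial>torus_uniform) = of_real ?s"
    using ip[of p] coeff_p * by (simp cong: sum.cong)
  have igp: "integrable torus_uniform (\<lambda>x. h x * cnj (p x))" if "h = g \<or> h = p" for h
  proof -
    have "integrable torus_uniform (\<lambda>x. \<Sum>m\<in>S. cnj (c m) * (h x * torus_char (- m) x))"
      using int[OF that] by (intro Bochner_Integration.integrable_sum integrable_mult_right)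
    then show ?thesis
      by (simp add: cnj_p sum_distrib_left mult_ac)
  qed
  have "0 \<le> (\<integral>x. (norm (g x - p x))\<^sup>2 \<partial>torus_uniform)"
    by simp
  also have "\<dots> = (\<integral>x. (norm (g x))\<^sup>2 - 2 * Re (g x * cnj (p x)) + Re (p x * cnj (p x)) \<partial>torus_uniform)"
    unfolding cmod_power2
    by (intro Bochner_Integration.integral_cong) (auto simp: power2_eq_square algebra_simps)
  also have "\<dots> = (\<integral>x. (norm (g x))\<^sup>2 \<partial>torus_uniform) - 2 * ?s + ?s"
  proof -
    have "integrable torus_uniform (\<lambda>x. (norm (g x))\<^sup>2)"
      using bd by (intro integrable_torus_bounded[of _ 1]) (auto simp: power_le_one)
    then show ?thesis
      using igp[of g] igp[of p] gp pp
      by (simp add: integral_Re del: times_complex.sel of_real_sum of_real_power)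
  qed
  also have "(\<integral>x. (norm (g x))\<^sup>2 \<partial>torus_uniform) \<le> (\<integral>x. 1 \<partial>(torus_uniform :: (real ^ 'd) measure))"
    using bd by (intro integral_mono integrable_torus_bounded[of _ 1]) (auto simp: power_le_one)
  also have "(\<integral>x. 1 \<partial>(torus_uniform :: (real ^ 'd) measure)) = (1 :: real)"
    by simp
  finally show ?thesis
    by (simp add: c_def)
qed

subsection \<open>Uniqueness of Fourier coefficients at a point of continuity\<close>

text \<open>The powers of a peak function concentrate at the peak, so they detect the sign of \<open>G 0\<close>.\<close>

lemma peak_powers_detect_sign:
  fixes G w :: "'a::euclidean_space \<Rightarrow> real"
  assumes K: "compact K" "0 \<in> interior K"
    and G [measurable]: "G \<in> borel_measurable borel" and bd: "\<And>x. \<bar>G x\<bar> \<le> B" and "isCont G 0"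
    and w: "continuous_on UNIV w" "\<And>x. 0 \<le> w x" "w 0 = 1" "\<And>x. x \<in> K \<Longrightarrow> x \<noteq> 0 \<Longrightarrow> w x < 1"
    and zero: "\<And>N. (\<integral>x. indicat_real K x * (G x * w x ^ N) \<partial>lborel) = 0"
  shows "G 0 \<le> 0"
proof (rule ccontr)
  assume "\<not> G 0 \<le> 0"
  \<comment> \<open>If \<open>G 0\<close> were positive, \<open>a\<close> would be a positive lower
    bound for \<open>G\<close> near 0.\<close>
  define a where "a = G 0 / 2"
  have "a > 0" "a < G 0"
    using \<open>\<not> G 0 \<le> 0\<close> by (auto simp: a_def)
  have B: "0 \<le> B"
    using bd[of 0] by linarith
  have [measurable]: "w \<in> borel_measurable borel" "K \<in> sets borel"
    using w(1) K(1) by (auto intro: borel_measurable_continuous_onI borel_compact)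
  have "\<forall>\<^sub>F x in nhds 0. a < G x"
    using \<open>isCont G 0\<close> \<open>a < G 0\<close> unfolding continuous_at isCont_def
    by (intro order_tendstoD(1)[of G "G 0"]) (auto simp: tendsto_at_iff_tendsto_nhds)
  then obtain d where d: "d > 0" "\<And>x. x \<in> ball 0 d \<Longrightarrow> a < G x"
    by (auto simp: eventually_nhds_metric dist_commute)
  \<comment> \<open>\<open>\<rho>\<close> bounds \<open>w\<close> on the part of \<open>K\<close>
    outside the ball where \<open>G\<close> exceeds \<open>a\<close>: its maximum there by
    compactness, or 0 if that part is empty.\<close>
  obtain \<rho> where \<rho>: "0 \<le> \<rho>" "\<rho> < 1" "\<And>x. x \<in> K - ball 0 d \<Longrightarrow> w x \<le> \<rho>"
  proof (cases "K - ball 0 d = {}")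
    case True
    then show ?thesis
      using that[of 0] by (metis empty_iff order_refl zero_less_one)
  next
    case False
    have "compact (K - ball 0 d)"
      using K(1) by (intro compact_diff) auto
    then obtain y where "y \<in> K - ball 0 d" "\<forall>x\<in>K - ball 0 d. w x \<le> w y"
      using False continuous_attains_sup[of "K - ball 0 d" w] continuous_on_subset[OF w(1)] by blast
    moreover have "y \<noteq> 0"
      using calculation d(1) by auto
    ultimately show ?thesis
      using that[of "w y"] w by auto
  qed
  \<comment> \<open>Any level strictly between \<open>\<rho>\<close> and 1 would do. Near 0 the
    function \<open>w\<close> exceeds it, so powers of \<open>w\<close> there outgrow those far from
    0.\<close>
  define \<rho>' where "\<rho>' = (1 + \<rho>) / 2"
  have \<rho>': "\<rho> < \<rho>'" "\<rho>' < 1" "0 < \<rho>'"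
    using \<rho> by (auto simp: \<rho>'_def)
  have "\<forall>\<^sub>F x in nhds 0. \<rho>' < w x"
    using w(1) \<open>\<rho>' < 1\<close> unfolding w(3)[symmetric] continuous_on_eq_continuous_at[OF open_UNIV] isCont_def
    by (intro order_tendstoD(1)[of w "w 0"]) (simp_all add: tendsto_at_iff_tendsto_nhds)
  then obtain d1 where d1: "d1 > 0" "\<And>x. x \<in> ball 0 d1 \<Longrightarrow> \<rho>' < w x"
    by (auto simp: eventually_nhds_metric dist_commute)
  obtain d2 where d2: "d2 > 0" "ball 0 d2 \<subseteq> K"
    using K(2) by (auto simp: mem_interior)
  define e where "e = min d (min d1 d2)"
  have e: "e > 0" "ball 0 e \<subseteq> ball 0 d" "ball 0 e \<subseteq> ball 0 d1" "ball 0 e \<subseteq> K"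
    using d d1 d2 by (auto simp: e_def)
  define V where "V = measure lborel (ball (0::'a) e)"
  define W where "W = measure lborel K"
  have "V > 0"
    using e(1) content_ball_pos unfolding V_def by auto
  have fin: "emeasure lborel (ball (0::'a) e) < \<infinity>" "emeasure lborel K < \<infinity>"
    by (intro emeasure_bounded_finite compact_imp_bounded K bounded_ball)+
  \<comment> \<open>The integrand is at least \<open>a * \<rho>' ^ N\<close> on the small ball,
    nonnegative on the rest of \<open>K\<close> inside \<open>ball 0 d\<close>, and at least
    \<open>- B * \<rho> ^ N\<close> on the remainder of \<open>K\<close>. Since its integral is 0,
    the gain on the small ball cannot exceed the possible loss.\<close>
  have bound: "a * V * \<rho>' ^ N \<le> B * W * \<rho> ^ N" for N
  proof -
    let ?l = "\<lambda>x. a * \<rho>' ^ N * indicat_real (ball 0 e) x - B * \<rho> ^ N * indicat_real K x"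
    have wK: "w x \<le> 1" if "x \<in> K" for x
      using w(3) w(4)[OF that] by (cases "x = 0") auto
    have ind: "integrable lborel (indicat_real (ball (0::'a) e))" "integrable lborel (indicat_real K)"
      using fin by (auto intro!: integrable_real_indicator)
    have "(\<integral>x. ?l x \<partial>lborel) \<le> (\<integral>x. indicat_real K x * (G x * w x ^ N) \<partial>lborel)"
    proof (rule integral_mono)
      show "integrable lborel ?l"
        using ind by (intro Bochner_Integration.integrable_diff integrable_mult_right)
      show "integrable lborel (\<lambda>x. indicat_real K x * (G x * w x ^ N))"
      proof (rule Bochner_Integration.integrable_bound[of _ "\<lambda>x. B * indicat_real K x"])
        show "integrable lborel (\<lambda>x. B * indicat_real K x)"
          using ind by simp
        show "AE x in lborel. norm (indicat_real K x * (G x * w x ^ N)) \<le> norm (B * indicat_real K x)"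
        proof (rule AE_I2)
          fix x
          have "\<bar>G x\<bar> * w x ^ N \<le> B * 1" if "x \<in> K"
            using bd w(2) wK[OF that] B by (intro mult_mono power_le_one) auto
          then show "norm (indicat_real K x * (G x * w x ^ N)) \<le> norm (B * indicat_real K x)"
            using w(2) B by (auto simp: indicator_def abs_mult)
        qed
      qed measurable
      fix x :: 'a
      consider "x \<notin> K" | "x \<in> ball 0 e" | "x \<in> K" "x \<notin> ball 0 e" "x \<in> ball 0 d" | "x \<in> K - ball 0 d"
        by blast
      then show "?l x \<le> indicat_real K x * (G x * w x ^ N)"
      proof cases
        case 1
        then show ?thesis
          using e by (auto simp: indicator_def)
      next
        case 2
        then have "a < G x" "\<rho>' < w x"
          using e d(2)[of x] d1(2)[of x] by blast+
        then have "a * \<rho>' ^ N \<le> G x * w x ^ N"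
          using \<rho>' \<open>a > 0\<close> by (intro mult_mono power_mono) auto
        moreover have "0 \<le> B * \<rho> ^ N"
          using B \<rho> by simp
        moreover have "x \<in> K"
          using 2 e by blast
        ultimately show ?thesis
          using 2 by (simp add: indicator_def)
      next
        case 3
        then have "0 \<le> G x * w x ^ N"
          using d(2)[of x] w(2) \<open>a > 0\<close> by simp
        moreover have "0 \<le> B * \<rho> ^ N"
          using B \<rho> by simp
        ultimately show ?thesis
          using 3 by (simp add: indicator_def)
      next
        case 4
        then have "\<bar>G x * w x ^ N\<bar> \<le> B * \<rho> ^ N"
          using bd[of x] \<rho>(3)[of x] w(2)[of x] B
          by (auto simp: abs_mult intro!: mult_mono power_mono)
        moreover have "x \<notin> ball 0 e"
          using 4 e(2) by blast
        ultimately show ?thesis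
          using 4 by (simp add: indicator_def)
      qed
    qed
    also have "(\<integral>x. ?l x \<partial>lborel) = a * \<rho>' ^ N * V - B * \<rho> ^ N * W"
      using ind by (simp add: V_def W_def)
    finally show ?thesis
      using zero by (simp add: mult_ac)
  qed
  \<comment> \<open>Dividing by \<open>\<rho>' ^ N\<close> leaves powers of a ratio below 1, which
    forces \<open>a * V \<le> 0\<close> in the limit.\<close>
  have "(\<lambda>N. B * W * (\<rho> / \<rho>') ^ N) \<longlonglongrightarrow> B * W * 0"
    using \<rho> \<rho>' by (intro tendsto_mult tendsto_const LIMSEQ_power_zero) auto
  moreover have "a * V \<le> B * W * (\<rho> / \<rho>') ^ N" for N
    using bound[of N] \<rho>' by (simp add: power_divide field_simps)
  ultimately have "a * V \<le> 0"
    by (auto intro: LIMSEQ_le_const)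
  then show False
    using \<open>a > 0\<close> \<open>V > 0\<close> by (simp add: mult_le_0_iff)
qed

text \<open>Each factor is the square of \<open>cos (pi * x $ k)\<close>, so the values lie in
  [0, 1] and 1 is attained exactly at the lattice points.\<close>

definition torus_peak :: "real ^ 'd \<Rightarrow> real" where
  "torus_peak x = (\<Prod>k\<in>UNIV. (1 + cos (2 * pi * x $ k)) / 2)"

lemma continuous_on_torus_peak: "continuous_on S torus_peak"
  unfolding torus_peak_def by (intro continuous_intros) auto

lemma half_one_plus_cos:
  fixes t :: real
  shows "0 \<le> (1 + cos t) / 2" "(1 + cos t) / 2 \<le> 1"
proof -
  show "0 \<le> (1 + cos t) / 2"
    using add_left_mono[OF cos_ge_minus_one, of 1 t] by simp
  show "(1 + cos t) / 2 \<le> 1"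
    using add_left_mono[OF cos_le_one, of 1 t] by simp
qed

lemma torus_peak_nonneg: "0 \<le> torus_peak x"
  unfolding torus_peak_def by (intro prod_nonneg ballI half_one_plus_cos)

lemma torus_peak_0: "torus_peak 0 = 1"
  by (simp add: torus_peak_def)

text \<open>For a nonzero coordinate the angle has absolute value in (0, pi], where the cosine is
  strictly below 1; the remaining factors are at most 1.\<close>

lemma torus_peak_less_1:
  fixes x :: "real ^ 'd"
  assumes "x \<in> centered_cube" "x \<noteq> 0"
  shows "torus_peak x < 1"
proof -
  obtain k where k: "x $ k \<noteq> 0"
    using assms(2) by (auto simp: vec_eq_iff)
  have "\<bar>2 * pi * x $ k\<bar> \<le> pi"
    using assms(1) by (simp add: mem_centered_cube abs_mult mult.commute)
  then have "cos \<bar>2 * pi * x $ k\<bar> < cos 0"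
    using k by (intro cos_monotone_0_pi) auto
  then have "(1 + cos (2 * pi * x $ k)) / 2 < 1"
    by simp
  moreover have "torus_peak x = (1 + cos (2 * pi * x $ k)) / 2 *
      (\<Prod>k\<in>UNIV - {k}. (1 + cos (2 * pi * x $ k)) / 2)"
    unfolding torus_peak_def by (rule prod.remove) auto
  moreover have "(\<Prod>k\<in>UNIV - {k}. (1 + cos (2 * pi * x $ k)) / 2) \<le> 1"
    by (intro prod_le_1 conjI half_one_plus_cos)
  ultimately show ?thesis
    using half_one_plus_cos(1)[of "2 * pi * x $ k"]
    by (smt (verit, best) mult_left_le)
qed

text \<open>The peak function is a trigonometric polynomial, so integrals against its powers are
  combinations of Fourier coefficients.\<close>

lemma integral_torus_peak_power:
  fixes g :: "real ^ 'd \<Rightarrow> complex"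
  assumes g [measurable]: "g \<in> borel_measurable borel" and bd: "\<And>x. norm (g x) \<le> B"
    and zero: "\<And>m. torus_coeff g m = 0"
  shows "(\<integral>x. g x * of_real (torus_peak x ^ N) \<partial>torus_uniform) = 0"
proof -
  define w :: "'d \<Rightarrow> real ^ 'd \<Rightarrow> real" where "w k x = (1 + cos (2 * pi * x $ k)) / 2" for k x
  have w_measurable [measurable]: "w k \<in> borel_measurable borel" for k
    unfolding w_def by measurable
  have w_bound: "\<bar>w k x\<bar> \<le> 1" for k x
    using half_one_plus_cos[of "2 * pi * x $ k"] by (simp add: w_def)
  \<comment> \<open>By Euler's formula a factor involves only the frequencies 0 and plus or minus
    one unit vector.\<close>
  have w_char: "complex_of_real (w k x) =
      1 / 2 + (torus_char (axis k 1) x + torus_char (- axis k 1) x) / 4" for k x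
  proof -
    have "lattice_vec (axis k 1) \<bullet> x = x $ k"
    proof -
      have "lattice_vec (axis k 1) = (axis k 1 :: real ^ 'd)"
        by (simp add: vec_eq_iff axis_def)
      then show ?thesis
        by (simp add: inner_axis')
    qed
    then show ?thesis
      by (simp add: w_def torus_char_def lattice_vec_minus complex_eq_iff)
  qed
  \<comment> \<open>The invariant quantifies over all characters because multiplication by
    \<open>w k\<close> shifts the frequency. The bound on \<open>p\<close> keeps the integrals
    finite.\<close>
  define good where "good p \<longleftrightarrow> p \<in> borel_measurable borel \<and> (\<forall>x. \<bar>p x\<bar> \<le> 1) \<and>
    (\<forall>m. (\<integral>x. g x * of_real (p x) * torus_char m x \<partial>torus_uniform) = 0)" for p :: "real ^ 'd \<Rightarrow> real"
  have good_factor: "good (\<lambda>x. p x * w k x)" if "good p" for p k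
  proof -
    have p [measurable]: "p \<in> borel_measurable borel" and p1: "\<And>x. \<bar>p x\<bar> \<le> 1"
      and p0: "\<And>m. (\<integral>x. g x * of_real (p x) * torus_char m x \<partial>torus_uniform) = 0"
      using that by (auto simp: good_def)
    have "norm (g x * of_real (p x)) \<le> B" for x
      using mult_mono[OF bd[of x] p1[of x]] order_trans[OF norm_ge_zero bd[of x]]
      by (simp add: norm_mult)
    then have int: "integrable torus_uniform (\<lambda>x. g x * of_real (p x) * torus_char m x)" for m
      by (intro integrable_torus_coeff[of _ B]) auto
    have "(\<integral>x. g x * of_real (p x * w k x) * torus_char m x \<partial>torus_uniform) = 0" for m
    proof -
      have "(\<integral>x. g x * of_real (p x * w k x) * torus_char m x \<partial>torus_uniform) =
          (\<integral>x. 1 / 2 * (g x * of_real (p x) * torus_char m x) +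
            1 / 4 * (g x * of_real (p x) * torus_char (axis k 1 + m) x) +
            1 / 4 * (g x * of_real (p x) * torus_char (- axis k 1 + m) x) \<partial>torus_uniform)"
        unfolding of_real_mult w_char torus_char_add_index
        by (intro Bochner_Integration.integral_cong) (auto simp: field_simps)
      also have "\<dots> = 0"
        using int by (simp add: p0)
      finally show ?thesis .
    qed
    moreover have "\<bar>p x * w k x\<bar> \<le> 1" for x
      using p1[of x] w_bound[of k x] by (simp add: abs_mult mult_le_one)
    ultimately show ?thesis
      by (auto simp: good_def)
  qed
  have good_prod: "good (\<lambda>x. p x * (\<Prod>k\<in>I. w k x))" if "good p" "finite I" for p I
    using that(2)
  proof (induction I rule: finite_induct)
    case empty
    then show ?case using that(1) by simp
  next
    case (insert k I)
    then show ?case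
      using good_factor[OF insert.IH, of k] by (simp add: mult_ac)
  qed
  have "good (\<lambda>x. torus_peak x ^ N)"
  proof (induction N)
    case 0
    have "(\<integral>x. g x * torus_char m x \<partial>torus_uniform) = 0" for m
      using zero[of "- m"] by (simp add: torus_coeff_def)
    then show ?case
      by (simp add: good_def)
  next
    case (Suc N)
    then show ?case
      using good_prod[OF Suc, of UNIV] by (simp add: torus_peak_def w_def mult_ac)
  qed
  then have "(\<integral>x. g x * of_real (torus_peak x ^ N) * torus_char 0 x \<partial>torus_uniform) = 0"
    unfolding good_def by blast
  then show ?thesis
    by simp
qed

lemma torus_peak_periodic: "lattice_periodic (torus_peak :: real ^ 'd \<Rightarrow> real)"
proof -
  have "cos (2 * pi * (t + of_int n)) = cos (2 * pi * t)" for t and n :: int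
    by (simp add: distrib_left cos_add cos_int_2pin sin_int_2pin)
  then show ?thesis
    by (simp add: lattice_periodic_def torus_peak_def)
qed

text \<open>Integrals of \<open>g\<close> against all powers of the peak function vanish, hence so
  do those of \<open>Re (c * g x)\<close>. The sign criterion on the centered cube then bounds
  \<open>Re (c * g 0)\<close> for every unimodular \<open>c\<close>.\<close>

lemma torus_coeff_zero_imp_zero:
  fixes g :: "real ^ 'd \<Rightarrow> complex"
  assumes g [measurable]: "g \<in> borel_measurable borel" and bd: "\<And>x. norm (g x) \<le> B"
    and per: "lattice_periodic g" and cont: "isCont g 0"
    and zero: "\<And>m. torus_coeff g m = 0"
  shows "g 0 = 0"
proof -
  have peak_measurable [measurable]: "torus_peak \<in> borel_measurable (borel :: (real ^ 'd) measure)"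
    by (intro borel_measurable_continuous_onI continuous_on_torus_peak)
  have "Re (c * g 0) \<le> 0" if c: "norm c = 1" for c
  proof (rule peak_powers_detect_sign[where K = centered_cube and w = torus_peak and B = B])
    show "(\<lambda>x. Re (c * g x)) \<in> borel_measurable borel"
      by measurable
    show "\<bar>Re (c * g x)\<bar> \<le> B" for x
      using abs_Re_le_cmod[of "c * g x"] bd[of x] c by (simp add: norm_mult)
    show "isCont (\<lambda>x. Re (c * g x)) 0"
      using cont by (intro isCont_Re continuous_mult continuous_const)
    show "(\<integral>x. indicat_real centered_cube x * (Re (c * g x) * torus_peak x ^ N) \<partial>lborel) = 0" for N
    proof -
      have "(\<integral>x. indicat_real centered_cube x * (Re (c * g x) * torus_peak x ^ N) \<partial>lborel) =
          (\<integral>x. Re (c * g x) * torus_peak x ^ N \<partial>torus_uniform)"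
        using per torus_peak_periodic[where 'd = 'd]
        by (subst integral_torus_centered) (auto simp: lattice_periodic_def)
      also have "\<dots> = (\<integral>x. Re (c * (g x * of_real (torus_peak x ^ N))) \<partial>torus_uniform)"
        by (intro Bochner_Integration.integral_cong) (auto simp: algebra_simps)
      also have "\<dots> = Re (\<integral>x. c * (g x * of_real (torus_peak x ^ N)) \<partial>torus_uniform)"
      proof (rule integral_Re)
        have "\<bar>torus_peak x\<bar> \<le> 1" for x :: "real ^ 'd"
          unfolding torus_peak_def abs_prod
          using half_one_plus_cos by (intro prod_le_1) (auto simp: abs_of_nonneg)
        then have "norm (c * (g x * of_real (torus_peak x ^ N))) \<le> B" for x
          using mult_mono[OF bd[of x], of "\<bar>torus_peak x\<bar> ^ N" 1] order_trans[OF norm_ge_zero bd[of x]] c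
          by (simp add: norm_mult power_le_one power_abs norm_power)
        then show "integrable torus_uniform (\<lambda>x. c * (g x * of_real (torus_peak x ^ N)))"
          by (intro integrable_torus_bounded[of _ B]) auto
      qed
      also have "\<dots> = 0"
        using integral_torus_peak_power[OF g bd zero, of N] by simp
      finally show ?thesis .
    qed
  qed (simp_all add: interior_cbox mem_box_cart continuous_on_torus_peak torus_peak_nonneg
      torus_peak_0 torus_peak_less_1)
  \<comment> \<open>These four values of \<open>c\<close> bound the real and imaginary parts of
    \<open>g 0\<close> from both sides.\<close>
  from this[of 1] this[of "-1"] this[of \<i>] this[of "-\<i>"] show ?thesis
    by (simp add: complex_eq_iff)
qed

text \<open>By the Weierstrass M-test the series converges uniformly, so its sum is continuous.
  Termwise integration recovers the coefficients, and at 0 all characters equal 1.\<close>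

lemma trigonometric_series:
  fixes a :: "int ^ 'd \<Rightarrow> complex"
  assumes "(\<lambda>m. norm (a m)) summable_on UNIV"
  obtains h where "continuous_on UNIV h" "lattice_periodic h" "bounded (range h)"
    "\<And>m. torus_coeff h m = a m" "(a has_sum h 0) UNIV"
proof
  define b :: "nat \<Rightarrow> int ^ 'd" where "b = from_nat_into UNIV"
  have b: "bij b"
    by (simp add: b_def bij_enum_lattice)
  define h where "h x = (\<Sum>n. a (b n) * torus_char (b n) x)" for x
  have "(\<lambda>n. norm (a (b n))) summable_on UNIV"
    using summable_on_reindex_bij_betw[OF b, of "\<lambda>m. norm (a m)"] assms by simp
  then have sum: "summable (\<lambda>n. norm (a (b n)))"
    by (rule summable_on_imp_summable)
  have sum_x: "summable (\<lambda>n. norm (a (b n) * torus_char (b n) x))" for x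
    using sum by (simp add: norm_mult)
  have "uniform_limit UNIV (\<lambda>n x. \<Sum>i<n. a (b i) * torus_char (b i) x) h sequentially"
    unfolding h_def by (rule Weierstrass_m_test[OF _ sum]) (simp add: norm_mult)
  then show cont: "continuous_on UNIV h"
    by (rule uniform_limit_theorem[rotated])
      (auto intro!: always_eventually continuous_intros continuous_on_torus_char)
  show "lattice_periodic h"
    by (simp add: lattice_periodic_def h_def torus_char_add torus_char_lattice_vec)
  have "norm (h x) \<le> (\<Sum>n. norm (a (b n)))" for x
    using summable_norm[OF sum_x[of x]] by (simp add: h_def norm_mult)
  then show "bounded (range h)"
    by (auto simp: bounded_iff)
  show "torus_coeff h m = a m" for m
  proof -
    have "torus_coeff h m = (\<integral>x. (\<Sum>n. a (b n) * torus_char (b n - m) x) \<partial>torus_uniform)"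
      using suminf_mult2[OF summable_norm_cancel[OF sum_x]]
      by (simp add: torus_coeff_def h_def mult.assoc flip: torus_char_add_index)
    also have "\<dots> = (\<Sum>n. \<integral>x. a (b n) * torus_char (b n - m) x \<partial>torus_uniform)"
    proof (rule integral_suminf)
      show "integrable torus_uniform (\<lambda>x. a (b n) * torus_char (b n - m) x)" for n
        by (intro integrable_torus_bounded[of _ "norm (a (b n))"]) (auto simp: norm_mult)
    qed (use sum in \<open>auto simp: norm_mult\<close>)
    also have "\<dots> = (\<Sum>n. if b n = m then a (b n) else 0)"
      by (simp add: integral_torus_char if_distrib cong: if_cong)
    also have "\<dots> = a m"
    proof -
      obtain i where i: "m = b i"
        using b by (metis bij_pointE)
      then have "(\<lambda>n. if b n = m then a (b n) else 0) = (\<lambda>n. if n = i then a (b n) else 0)"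
        using b by (auto simp: fun_eq_iff bij_is_inj inj_eq)
      then show ?thesis
        using sums_single[of i "\<lambda>n. a (b n)"] i by (simp add: sums_iff)
    qed
    finally show ?thesis .
  qed
  have "((\<lambda>n. a (b n)) has_sum h 0) UNIV"
    using sum summable_sums[OF summable_norm_cancel[OF sum]]
    by (intro norm_summable_imp_has_sum) (auto simp: h_def)
  then show "(a has_sum h 0) UNIV"
    using has_sum_reindex_bij_betw[OF b] by blast
qed

subsection \<open>Convolution powers\<close>

text \<open>Index shift: \<open>conv_power f k\<close> is the convolution of \<open>k + 1\<close> copies of \<open>f\<close>.\<close>

primrec conv_power :: "(real ^ 'd \<Rightarrow> real) \<Rightarrow> nat \<Rightarrow> real ^ 'd \<Rightarrow> real" where
  "conv_power f 0 = f"
| "conv_power f (Suc k) = (\<lambda>x. \<integral>z. f (x - z) * conv_power f k z \<partial>torus_uniform)"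

text \<open>Abstracts the ball indicator on the torus. Evenness and almost everywhere continuity
  enter as separate assumptions of the last two lemmas.\<close>

locale torus_kernel =
  fixes f :: "real ^ 'd \<Rightarrow> real"
  assumes measurable_kernel [measurable]: "f \<in> borel_measurable borel"
    and kernel_periodic: "lattice_periodic f"
    and kernel_nonneg: "0 \<le> f x"
    and kernel_le_1: "f x \<le> 1"
begin

section \<open>Bounds, periodicity and Fourier coefficients of convolution powers\<close>

lemma measurable_conv_power [measurable]: "conv_power f k \<in> borel_measurable borel"
proof (induction k)
  case 0
  then show ?case by simp
next
  case (Suc k)
  note [measurable] = Suc
  have "(\<lambda>x. \<integral>z. f (x - z) * conv_power f k z \<partial>torus_uniform) \<in> borel_measurable borel"
    by measurable
  then show ?case
    by simp
qed

lemma conv_power_bounds: "0 \<le> conv_power f k x \<and> conv_power f k x \<le> 1"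
proof (induction k arbitrary: x)
  case 0
  then show ?case by (simp add: kernel_nonneg kernel_le_1)
next
  case (Suc k)
  have *: "0 \<le> f (x - z) * conv_power f k z" "f (x - z) * conv_power f k z \<le> 1" for z
    using Suc[of z] kernel_nonneg kernel_le_1 by (auto intro: mult_le_one)
  have "(\<integral>z. f (x - z) * conv_power f k z \<partial>torus_uniform) \<le> (\<integral>z. 1 \<partial>(torus_uniform :: (real ^ 'd) measure))"
    using * by (intro integral_mono integrable_torus_bounded[of _ 1]) auto
  then show ?case
    using * by (auto intro!: integral_nonneg)
qed

lemma conv_power_nonneg: "0 \<le> conv_power f k x"
  and conv_power_le_1: "conv_power f k x \<le> 1"
  using conv_power_bounds by auto

lemma conv_power_periodic: "lattice_periodic (conv_power f k)"
proof (cases k)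
  case 0
  then show ?thesis by (simp add: kernel_periodic)
next
  case (Suc j)
  have "f (x + lattice_vec u - z) = f (x - z)" for x u z
    using lattice_periodicD[OF kernel_periodic, of "x - z" u] by (simp add: algebra_simps)
  then show ?thesis
    by (simp add: Suc lattice_periodic_def)
qed

text \<open>Substituting \<open>z + x\<close> for \<open>z\<close> is allowed by translation
  invariance and moves the base point to 0. This is how a vertex \<open>z\<close> between
  \<open>x\<close> and \<open>y\<close> is integrated out.\<close>

lemma conv_power_translate:
  "(\<integral>z. f (y - z) * conv_power f k (z - x) \<partial>torus_uniform) = conv_power f (Suc k) (y - x)"
proof -
  have per: "f (a - (z + lattice_vec u)) = f (a - z)" for a z u
    using lattice_periodicD[OF kernel_periodic, of "a - z - lattice_vec u" u] by (simp add: algebra_simps)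
  have per': "conv_power f k (z + lattice_vec u - x) = conv_power f k (z - x)" for z u
    using lattice_periodicD[OF conv_power_periodic, of k "z - x" u] by (simp add: algebra_simps)
  have "(\<integral>z. f (y - z) * conv_power f k (z - x) \<partial>torus_uniform) =
      (\<integral>z. f (y - (z + x)) * conv_power f k (z + x - x) \<partial>torus_uniform)"
    by (rule integral_torus_translate[symmetric]) (auto simp: lattice_periodic_def per per')
  then show ?thesis
    by (simp add: algebra_simps)
qed

text \<open>The convolution theorem: after Fubini, translating \<open>x\<close> by \<open>z\<close>
  splits the character, and the double integral factors.\<close>

lemma torus_coeff_conv_power:
  "torus_coeff (\<lambda>x. of_real (conv_power f k x)) m = torus_coeff (\<lambda>x. of_real (f x)) m ^ Suc k"
proof (induction k)
  case 0
  then show ?case by simp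
next
  case (Suc k)
  interpret pair_sigma_finite "torus_uniform :: (real ^ 'd) measure" "torus_uniform :: (real ^ 'd) measure" ..
  interpret P: prob_space "torus_uniform \<Otimes>\<^sub>M torus_uniform :: ((real ^ 'd) \<times> (real ^ 'd)) measure"
    by (intro prob_space_pair prob_space_torus_uniform)
  let ?U = "torus_uniform :: (real ^ 'd) measure"
  let ?F = "\<lambda>x z. complex_of_real (f (x - z)) * of_real (conv_power f k z) * torus_char (- m) x"
  have int: "integrable (?U \<Otimes>\<^sub>M ?U) (case_prod ?F)"
  proof (rule P.integrable_const_bound[of _ 1])
    show "AE x in ?U \<Otimes>\<^sub>M ?U. norm (case_prod ?F x) \<le> 1"
      using kernel_nonneg kernel_le_1 conv_power_nonneg conv_power_le_1
      by (auto simp: norm_mult intro!: mult_le_one AE_I2)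
  qed measurable
  have "torus_coeff (\<lambda>x. of_real (conv_power f (Suc k) x)) m = (\<integral>x. (\<integral>z. ?F x z \<partial>?U) \<partial>?U)"
    by (simp add: torus_coeff_def flip: integral_complex_of_real)
  also have "\<dots> = (\<integral>z. (\<integral>x. ?F x z \<partial>?U) \<partial>?U)"
    using Fubini_integral[OF int] by simp
  also have "\<dots> = (\<integral>z. of_real (conv_power f k z) * torus_char (- m) z *
      torus_coeff (\<lambda>x. of_real (f x)) m \<partial>?U)"
  proof (intro Bochner_Integration.integral_cong refl)
    fix z
    have "(\<integral>x. ?F x z \<partial>?U) = (\<integral>x. ?F (x + z) z \<partial>?U)"
    proof (rule integral_torus_translate[symmetric])
      show "lattice_periodic (\<lambda>x. ?F x z)"
        using lattice_periodicD[OF kernel_periodic, of "_ - z"]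
        by (simp add: lattice_periodic_def diff_add_eq torus_char_add torus_char_lattice_vec)
    qed measurable
    also have "\<dots> = (\<integral>x. of_real (conv_power f k z) * torus_char (- m) z *
        (of_real (f x) * torus_char (- m) x) \<partial>?U)"
      by (simp add: torus_char_add mult_ac)
    finally show "(\<integral>x. ?F x z \<partial>?U) = of_real (conv_power f k z) * torus_char (- m) z *
      torus_coeff (\<lambda>x. of_real (f x)) m"
      by (simp add: torus_coeff_def)
  qed
  also have "\<dots> = torus_coeff (\<lambda>x. of_real (conv_power f k x)) m * torus_coeff (\<lambda>x. of_real (f x)) m"
    by (simp add: torus_coeff_def)
  finally show ?case
    by (simp add: Suc)
qed

text \<open>The integrand is a path \<open>p 0, ..., p k\<close> closed up by a convolution power.
  Integrating out the last vertex shortens the path by one and raises the index of the closing power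
  by one, hence the induction with \<open>j\<close> arbitrary. At \<open>k = 0\<close> the integrand
  is constant; for \<open>j = 0\<close> the closing factor is \<open>f\<close> and the path becomes
  a cycle.\<close>

lemma integral_path:
  fixes p :: "nat \<Rightarrow> 'i"
  assumes "inj_on p {..k}"
  shows "(\<integral>x. (\<Prod>i<k. f (x (p i) - x (p (Suc i)))) * conv_power f j (x (p k) - x (p 0))
    \<partial>Pi\<^sub>M (p ` {..k}) (\<lambda>_. torus_uniform)) = conv_power f (j + k) 0"
  using assms
proof (induction k arbitrary: j)
  case 0
  interpret P: prob_space "Pi\<^sub>M {p 0} (\<lambda>_. torus_uniform :: (real ^ 'd) measure)"
    by (intro prob_space_PiM prob_space_torus_uniform)
  show ?case
    using P.prob_space by simp
next
  case (Suc k)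
  interpret product_sigma_finite "\<lambda>_::'i. torus_uniform :: (real ^ 'd) measure" ..
  let ?I = "p ` {..k}"
  let ?P = "\<lambda>x. \<Prod>i<k. f (x (p i) - x (p (Suc i)))"
  let ?F = "\<lambda>x. (\<Prod>i<Suc k. f (x (p i) - x (p (Suc i)))) * conv_power f j (x (p (Suc k)) - x (p 0))"
  interpret P: prob_space "Pi\<^sub>M (insert (p (Suc k)) ?I) (\<lambda>_. torus_uniform :: (real ^ 'd) measure)"
    by (intro prob_space_PiM prob_space_torus_uniform)
  have notin: "p (Suc k) \<notin> ?I"
    using Suc.prems by (fastforce simp: inj_on_def)
  have ne: "p i \<noteq> p (Suc k)" if "i \<le> k" for i
    using notin that by (metis atMost_iff imageI)
  have [measurable]: "(\<lambda>x. x (p i)) \<in> Pi\<^sub>M (insert (p (Suc k)) ?I) (\<lambda>_. torus_uniform :: (real ^ 'd) measure) \<rightarrow>\<^sub>M borel"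
    if "i \<le> Suc k" for i
    using that measurable_component_singleton[of "p i" "insert (p (Suc k)) ?I" "\<lambda>_. torus_uniform :: (real ^ 'd) measure"]
    by (auto simp: le_Suc_eq)
  have "integrable (Pi\<^sub>M (insert (p (Suc k)) ?I) (\<lambda>_. torus_uniform)) ?F"
  proof (rule P.integrable_const_bound[of _ 1])
    have "0 \<le> ?F x \<and> ?F x \<le> 1" for x
      using kernel_nonneg kernel_le_1 conv_power_nonneg conv_power_le_1
      by (intro conjI mult_le_one mult_nonneg_nonneg prod_nonneg prod_le_1) auto
    then show "AE x in Pi\<^sub>M (insert (p (Suc k)) ?I) (\<lambda>_. torus_uniform). norm (?F x) \<le> 1"
      by auto
    have [measurable]: "(\<lambda>x. x (p i)) \<in> Pi\<^sub>M (insert (p (Suc k)) ?I) (\<lambda>_. torus_uniform :: (real ^ 'd) measure) \<rightarrow>\<^sub>M borel"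
      "(\<lambda>x. x (p (Suc i))) \<in> Pi\<^sub>M (insert (p (Suc k)) ?I) (\<lambda>_. torus_uniform :: (real ^ 'd) measure) \<rightarrow>\<^sub>M borel"
      if "i \<in> {..<Suc k}" for i
      using that by auto
    show "?F \<in> borel_measurable (Pi\<^sub>M (insert (p (Suc k)) ?I) (\<lambda>_. torus_uniform))"
      by measurable
  qed
  then have "(\<integral>x. ?F x \<partial>Pi\<^sub>M (insert (p (Suc k)) ?I) (\<lambda>_. torus_uniform)) =
      (\<integral>x. (\<integral>z. ?F (x(p (Suc k) := z)) \<partial>torus_uniform) \<partial>Pi\<^sub>M ?I (\<lambda>_. torus_uniform))"
    using notin by (intro product_integral_insert) auto
  also have "\<dots> = (\<integral>x. ?P x * (\<integral>z. f (x (p k) - z) * conv_power f j (z - x (p 0)) \<partial>torus_uniform)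
      \<partial>Pi\<^sub>M ?I (\<lambda>_. torus_uniform))"
  proof (intro Bochner_Integration.integral_cong refl)
    fix x :: "'i \<Rightarrow> real ^ 'd"
    have "?F (x(p (Suc k) := z)) = ?P x * (f (x (p k) - z) * conv_power f j (z - x (p 0)))" for z
    proof -
      have "?P (x(p (Suc k) := z)) = ?P x"
        using ne by (intro prod.cong) auto
      then show ?thesis
        using ne[of k] ne[of 0] by (simp add: mult.assoc)
    qed
    then show "(\<integral>z. ?F (x(p (Suc k) := z)) \<partial>torus_uniform) =
        ?P x * (\<integral>z. f (x (p k) - z) * conv_power f j (z - x (p 0)) \<partial>torus_uniform)"
      by simp
  qed
  also have "\<dots> = (\<integral>x. ?P x * conv_power f (Suc j) (x (p k) - x (p 0)) \<partial>Pi\<^sub>M ?I (\<lambda>_. torus_uniform))"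
    by (simp only: conv_power_translate)
  also have "\<dots> = conv_power f (Suc j + k) 0"
    using Suc.prems by (intro Suc.IH) (auto simp: inj_on_def)
  finally show ?case
    by (simp only: atMost_Suc image_insert add_Suc_right add_Suc)
qed

text \<open>Dominated convergence on the centered cube, with the indicator of the cube as majorant.
  Evenness rewrites \<open>f (s n - z)\<close> as \<open>f (z - s n)\<close>, so continuity of
  \<open>f\<close> at almost every \<open>z\<close> gives pointwise convergence.\<close>

lemma isCont_conv_power:
  assumes even: "\<And>x. f (- x) = f x"
    and cont: "AE x in lborel. x \<in> centered_cube \<longrightarrow> isCont f x"
  shows "isCont (conv_power f (Suc k)) 0"
  unfolding continuous_at_sequentially
proof (intro allI impI)
  fix s :: "nat \<Rightarrow> real ^ 'd"
  assume s: "s \<longlonglongrightarrow> 0"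
  let ?g = "\<lambda>x z. indicat_real centered_cube z * (f (x - z) * conv_power f k z)"
  have eq: "conv_power f (Suc k) x = (\<integral>z. ?g x z \<partial>lborel)" for x
  proof -
    have "f (x - (z + lattice_vec u)) = f (x - z)" for z u
      using lattice_periodicD[OF kernel_periodic, of "x - z - lattice_vec u" u] by (simp add: algebra_simps)
    then show ?thesis
      using lattice_periodicD[OF conv_power_periodic]
      by (simp, subst integral_torus_centered) (auto simp: lattice_periodic_def)
  qed
  have "(\<lambda>n. \<integral>z. ?g (s n) z \<partial>lborel) \<longlonglongrightarrow> (\<integral>z. ?g 0 z \<partial>lborel)"
  proof (rule integral_dominated_convergence[where w = "indicat_real centered_cube"])
    show "integrable lborel (indicat_real (centered_cube :: (real ^ 'd) set))"
      by (intro integrable_real_indicator emeasure_lborel_cbox_finite) auto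
    show "AE z in lborel. (\<lambda>n. ?g (s n) z) \<longlonglongrightarrow> ?g 0 z"
      using cont
    proof eventually_elim
      case (elim z)
      show ?case
      proof (cases "z \<in> centered_cube")
        case True
        have "(\<lambda>n. z - s n) \<longlonglongrightarrow> z - 0"
          by (intro tendsto_intros s)
        then have "(\<lambda>n. f (z - s n)) \<longlonglongrightarrow> f z"
          using elim True by (intro isCont_tendsto_compose[of z f]) auto
        moreover have "f (s n - z) = f (z - s n)" for n
          using even[of "s n - z"] by simp
        ultimately show ?thesis
          using True even by (auto intro!: tendsto_intros)
      qed auto
    qed
    show "AE z in lborel. norm (?g (s n) z) \<le> indicat_real centered_cube z" for n
      using kernel_nonneg kernel_le_1 conv_power_nonneg conv_power_le_1
      by (auto simp: indicator_def intro!: mult_le_one AE_I2)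
  qed measurable
  then show "(conv_power f (Suc k) \<circ> s) \<longlonglongrightarrow> conv_power f (Suc k) 0"
    by (simp only: eq comp_def)
qed

text \<open>The coefficients of \<open>f\<close> have norm at most 1, so their powers of exponent
  \<open>k + 2\<close> are dominated by their squares, which are summable by Bessel. The resulting
  continuous series and the convolution power share all Fourier coefficients and are continuous at
  0, so they agree there. The index \<open>Suc k\<close> stands for \<open>k + 2\<close> copies of
  \<open>f\<close>.\<close>

lemma has_sum_torus_coeff_power:
  assumes even: "\<And>x. f (- x) = f x"
    and cont: "AE x in lborel. x \<in> centered_cube \<longrightarrow> isCont f x"
  shows "((\<lambda>m. torus_coeff (\<lambda>x. of_real (f x)) m ^ (k + 2)) has_sum
    of_real (conv_power f (Suc k) 0)) UNIV"
proof -
  define c where "c = torus_coeff (\<lambda>x. complex_of_real (f x))"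
  define F where "F x = complex_of_real (conv_power f (Suc k) x)" for x
  have bessel: "(\<Sum>m\<in>S. (norm (c m))\<^sup>2) \<le> 1" if "finite S" for S
    unfolding c_def using that kernel_nonneg kernel_le_1 by (intro Bessel_torus) auto
  have c_le: "norm (c m) \<le> 1" for m
    using bessel[of "{m}"] by (simp add: power_le_one_iff)
  have sq: "(\<lambda>m. (norm (c m))\<^sup>2) summable_on UNIV"
    using bessel by (intro nonneg_bdd_above_summable_on) (auto simp: bdd_above_def)
  have "norm (c m ^ (k + 2)) \<le> (norm (c m))\<^sup>2" for m
    unfolding norm_power using c_le by (intro power_decreasing) auto
  then have "(\<lambda>m. norm (c m ^ (k + 2))) summable_on UNIV"
    by (rule summable_on_comparison_test[OF sq]) (rule norm_ge_zero)
  then obtain h where h: "continuous_on UNIV h" "lattice_periodic h" "bounded (range h)"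
      "\<And>m. torus_coeff h m = c m ^ (k + 2)" "((\<lambda>m. c m ^ (k + 2)) has_sum h 0) UNIV"
    by (rule trigonometric_series) blast
  obtain B where B: "\<And>x. norm (h x) \<le> B"
    using h(3) by (auto simp: bounded_iff)
  have [measurable]: "h \<in> borel_measurable borel"
    by (rule borel_measurable_continuous_onI[OF h(1)])
  have [measurable]: "F \<in> borel_measurable borel"
    unfolding F_def by measurable
  have F1: "norm (F x) \<le> 1" for x
    using conv_power_nonneg[of "Suc k" x] conv_power_le_1[of "Suc k" x]
    by (simp add: F_def del: conv_power.simps)
  have "F 0 - h 0 = 0"
  proof (rule torus_coeff_zero_imp_zero)
    show "norm (F x - h x) \<le> 1 + B" for x
      using norm_triangle_ineq4[of "F x" "h x"] F1[of x] B[of x] by linarith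
    show "lattice_periodic (\<lambda>x. F x - h x)"
      using lattice_periodicD[OF h(2)] lattice_periodicD[OF conv_power_periodic]
      by (simp add: lattice_periodic_def F_def del: conv_power.simps)
    have "isCont h 0"
      using h(1) by (simp add: continuous_on_eq_continuous_at)
    moreover have "isCont F 0"
      unfolding F_def using isCont_conv_power[OF even cont] by (intro continuous_of_real)
    ultimately show "isCont (\<lambda>x. F x - h x) 0"
      by (intro continuous_diff)
    show "torus_coeff (\<lambda>x. F x - h x) m = 0" for m
    proof -
      have "torus_coeff (\<lambda>x. F x - h x) m = torus_coeff F m - torus_coeff h m"
        using integrable_torus_coeff[of F 1 "- m"] integrable_torus_coeff[of h B "- m"] F1 B
        by (simp add: torus_coeff_def left_diff_distrib)
      also have "torus_coeff F m = c m ^ (k + 2)"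
        unfolding F_def torus_coeff_conv_power by (simp add: c_def)
      finally show ?thesis
        by (simp add: h(4))
    qed
  qed measurable
  then show ?thesis
    using h(5) by (simp add: c_def F_def del: conv_power.simps)
qed

end

subsection \<open>The geometric random graph\<close>

definition torus_ball_indicator :: "ereal \<Rightarrow> real \<Rightarrow> real ^ 'd \<Rightarrow> real" where
  "torus_ball_indicator \<sigma> r = indicator {x. torus_dist \<sigma> x 0 \<le> r}"

section \<open>Torus distance and the periodic ball indicator\<close>

lemma torus_dist_diff: "torus_dist \<sigma> (x - y) 0 = torus_dist \<sigma> x y"
  by (simp add: torus_dist_def)

text \<open>Writes adjacency as a kernel in the difference of two points, so that a cycle becomes a
  product of kernels.\<close>

lemma torus_ball_indicator_diff:
  "torus_ball_indicator \<sigma> r (x - y) = (if torus_dist \<sigma> x y \<le> r then 1 else 0)"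
  by (simp add: torus_ball_indicator_def indicator_def torus_dist_diff)

text \<open>A lattice shift only permutes the translates over which the infimum is taken.\<close>

lemma torus_dist_translate: "torus_dist \<sigma> (x + lattice_vec v) y = torus_dist \<sigma> x y"
proof -
  have "L_norm \<sigma> (x + lattice_vec v - y - lattice_vec u) =
      L_norm \<sigma> (x - y - lattice_vec (u - v))" for u
    using lattice_vec_add[of "u - v" v] by (simp add: algebra_simps)
  moreover have "range (\<lambda>u. L_norm \<sigma> (x - y - lattice_vec (u - v))) =
      range (\<lambda>u. L_norm \<sigma> (x - y - lattice_vec u))"
    by (auto intro: range_eqI[of _ _ "_ + v"])
  ultimately show ?thesis
    by (simp add: torus_dist_def)
qed

lemma torus_dist_commute: "torus_dist \<sigma> x y = torus_dist \<sigma> y x"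
proof -
  have "L_norm \<sigma> (x - y - lattice_vec u) = L_norm \<sigma> (y - x - lattice_vec (- u))" for u
    using L_norm_minus[of \<sigma> "x - y - lattice_vec u"] by (simp add: lattice_vec_minus algebra_simps)
  moreover have "range (\<lambda>u. L_norm \<sigma> (y - x - lattice_vec (- u))) =
      range (\<lambda>u. L_norm \<sigma> (y - x - lattice_vec u))"
    by (auto intro: range_eqI[of _ _ "- _"])
  ultimately show ?thesis
    by (simp add: torus_dist_def)
qed

lemma torus_ball_indicator_even: "torus_ball_indicator \<sigma> r (- x) = torus_ball_indicator \<sigma> r x"
  using torus_ball_indicator_diff[of \<sigma> r 0 x] torus_ball_indicator_diff[of \<sigma> r x 0]
  by (simp add: torus_dist_commute)

lemma borel_measurable_torus_dist:
  assumes "1 \<le> \<sigma>"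
  shows "(\<lambda>x. torus_dist \<sigma> x 0) \<in> borel_measurable (borel :: (real ^ 'd) measure)"
proof -
  note [measurable] = borel_measurable_L_norm[OF assms]
  show ?thesis
    unfolding torus_dist_def by (rule borel_measurable_cINF_real) auto
qed

lemma torus_kernel_torus_ball_indicator:
  assumes "1 \<le> \<sigma>"
  shows "torus_kernel (torus_ball_indicator \<sigma> r :: real ^ 'd \<Rightarrow> real)"
proof
  note [measurable] = borel_measurable_torus_dist[OF assms]
  show "torus_ball_indicator \<sigma> r \<in> borel_measurable (borel :: (real ^ 'd) measure)"
    unfolding torus_ball_indicator_def by measurable
  show "lattice_periodic (torus_ball_indicator \<sigma> r :: real ^ 'd \<Rightarrow> real)"
    by (simp add: lattice_periodic_def torus_ball_indicator_def indicator_def torus_dist_translate)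
qed (simp_all add: torus_ball_indicator_def)

text \<open>Subtracting a nonzero integer from a number in [-1/2, 1/2] does not decrease its
  absolute value, so by monotonicity of the norm the zero translate attains the infimum.\<close>

lemma torus_dist_centered:
  fixes x :: "real ^ 'd"
  assumes "1 \<le> \<sigma>" "x \<in> centered_cube"
  shows "torus_dist \<sigma> x 0 = L_norm \<sigma> x"
proof (rule antisym)
  have "L_norm \<sigma> x \<le> L_norm \<sigma> (x - lattice_vec u)" for u
  proof (rule L_norm_mono[OF assms(1)])
    fix k
    have "\<bar>x $ k\<bar> \<le> 1/2"
      using assms(2) by (simp add: mem_centered_cube)
    moreover have "u $ k = 0 \<or> 1 \<le> \<bar>real_of_int (u $ k)\<bar>"
      by linarith
    ultimately show "\<bar>x $ k\<bar> \<le> \<bar>(x - lattice_vec u) $ k\<bar>"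
      unfolding vector_minus_component lattice_vec_nth by (elim disjE; linarith)
  qed
  then show "L_norm \<sigma> x \<le> torus_dist \<sigma> x 0"
    by (simp add: torus_dist_def cINF_greatest)
  have "bdd_below (range (\<lambda>u. L_norm \<sigma> (x - 0 - lattice_vec u)))"
    by (auto intro!: bdd_belowI[of _ 0] L_norm_nonneg[OF assms(1)])
  then show "torus_dist \<sigma> x 0 \<le> L_norm \<sigma> x"
    unfolding torus_dist_def by (intro cINF_lower2[where x = 0]) auto
qed

lemma torus_ball_indicator_centered:
  assumes "1 \<le> \<sigma>" "x \<in> centered_cube"
  shows "torus_ball_indicator \<sigma> r x = indicator (L_ball \<sigma> r) x"
  using assms by (simp add: torus_ball_indicator_def L_ball_def torus_dist_centered indicator_def)

lemma L_ball_subset_centered_cube: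
  assumes "1 \<le> \<sigma>" "r \<le> 1/2"
  shows "L_ball \<sigma> r \<subseteq> centered_cube"
proof
  fix x assume "x \<in> L_ball \<sigma> r"
  then have "\<bar>x $ k\<bar> \<le> 1/2" for k
    using component_le_L_norm[OF assms(1), of x k] assms(2) by (simp add: L_ball_def)
  then show "x \<in> centered_cube"
    by (simp add: mem_centered_cube)
qed

text \<open>Off the sphere and inside the open cube the indicator is locally constant. The frontier
  of the cube is discarded as well because the identification with \<open>L_ball\<close> is
  available only within the cube, whose frontier the ball touches when
  \<open>r = 1/2\<close>.\<close>

lemma AE_isCont_torus_ball_indicator:
  assumes "1 \<le> \<sigma>" "0 < r"
  shows "AE x in lborel. x \<in> (centered_cube :: (real ^ 'd) set) \<longrightarrow>
    isCont (torus_ball_indicator \<sigma> r) x"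
  using AE_lborel_not_in_negligible[OF negligible_L_sphere[OF assms]]
    AE_lborel_not_in_negligible[OF negligible_frontier_interval[of "- vec (1/2)" "vec (1/2) :: real ^ 'd"]]
proof eventually_elim
  case (elim x)
  show ?case
  proof
    let ?C = "box (- vec (1/2)) (vec (1/2)) :: (real ^ 'd) set"
    assume "x \<in> centered_cube"
    then have "x \<in> ?C"
      using elim by blast
    have open_less: "open (?C \<inter> {y. L_norm \<sigma> y < r})" "open (?C \<inter> {y. r < L_norm \<sigma> y})"
      using assms by (auto intro!: open_Int open_Collect_less continuous_on_L_norm continuous_intros)
    have const: "isCont (torus_ball_indicator \<sigma> r) x"
      if "open S" "x \<in> S" "\<And>y. y \<in> S \<Longrightarrow> torus_ball_indicator \<sigma> r y = c" for S and c :: real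
    proof -
      have "\<forall>\<^sub>F y in nhds x. torus_ball_indicator \<sigma> r y = c"
        using that eventually_nhds by blast
      then show ?thesis
        using isCont_cong[of "torus_ball_indicator \<sigma> r" "\<lambda>_. c" x] by simp
    qed
    have eq: "torus_ball_indicator \<sigma> r y = indicator (L_ball \<sigma> r) y" if "y \<in> ?C" for y
      using that box_subset_cbox assms by (intro torus_ball_indicator_centered) blast+
    consider "L_norm \<sigma> x < r" | "r < L_norm \<sigma> x"
      using elim by fastforce
    then show "isCont (torus_ball_indicator \<sigma> r) x"
    proof cases
      case 1
      show ?thesis
        by (rule const[OF open_less(1), of 1]) (use 1 \<open>x \<in> ?C\<close> eq in \<open>auto simp: L_ball_def\<close>)
    next
      case 2
      show ?thesis
        by (rule const[OF open_less(2), of 0]) (use 2 \<open>x \<in> ?C\<close> eq in \<open>auto simp: L_ball_def\<close>)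
    qed
  qed
qed

text \<open>The centered cube contains the whole ball, so the torus integral over it is already the
  integral over the full space.\<close>

lemma torus_coeff_torus_ball_indicator:
  fixes m :: "int ^ 'd"
  assumes "1 \<le> \<sigma>" "r \<le> 1/2"
  shows "torus_coeff (\<lambda>x. of_real (torus_ball_indicator \<sigma> r x)) m =
    fourier_transform (indicator (L_ball \<sigma> r)) ((2 * pi) *\<^sub>R lattice_vec m)"
proof -
  interpret torus_kernel "torus_ball_indicator \<sigma> r :: real ^ 'd \<Rightarrow> real"
    by (rule torus_kernel_torus_ball_indicator[OF assms(1)])
  note [measurable] = borel_measurable_L_norm[OF assms(1)]
  have [measurable]: "(L_ball \<sigma> r :: (real ^ 'd) set) \<in> sets borel"
    unfolding L_ball_def by measurable
  let ?B = "L_ball \<sigma> r :: (real ^ 'd) set"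
  have "torus_coeff (\<lambda>x. of_real (torus_ball_indicator \<sigma> r x)) m =
      (\<integral>x. indicat_real centered_cube x *\<^sub>R
        (of_real (torus_ball_indicator \<sigma> r x) * torus_char (- m) x) \<partial>lborel)"
    unfolding torus_coeff_def
    using lattice_periodicD[OF kernel_periodic]
    by (intro integral_torus_centered)
      (auto simp: lattice_periodic_def torus_char_add torus_char_lattice_vec)
  also have "\<dots> = (\<integral>x. exp (- \<i> * of_real (((2 * pi) *\<^sub>R lattice_vec m) \<bullet> x)) *
      of_real (indicator ?B x) \<partial>lborel)"
  proof (intro Bochner_Integration.integral_cong refl)
    fix x :: "real ^ 'd"
    have "torus_char (- m) x = exp (- \<i> * of_real (((2 * pi) *\<^sub>R lattice_vec m) \<bullet> x))"
      by (simp add: torus_char_def lattice_vec_minus cis_conv_exp)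
    moreover have "indicat_real centered_cube x * torus_ball_indicator \<sigma> r x = indicator ?B x"
      using L_ball_subset_centered_cube[OF assms] torus_ball_indicator_centered[OF assms(1), of x r]
      by (auto simp: indicator_def)
    moreover have "indicat_real centered_cube x *\<^sub>R
        (of_real (torus_ball_indicator \<sigma> r x) * torus_char (- m) x) =
        torus_char (- m) x * of_real (indicat_real centered_cube x * torus_ball_indicator \<sigma> r x)"
      by (simp add: scaleR_conv_of_real mult_ac)
    ultimately show "indicat_real centered_cube x *\<^sub>R
        (of_real (torus_ball_indicator \<sigma> r x) * torus_char (- m) x) =
        exp (- \<i> * of_real (((2 * pi) *\<^sub>R lattice_vec m) \<bullet> x)) * of_real (indicator ?B x)"
      by simp
  qed
  also have "\<dots> = fourier_transform (indicator ?B) ((2 * pi) *\<^sub>R lattice_vec m)"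
    unfolding fourier_transform_def by (rule integral_completion[symmetric]) measurable
  finally show ?thesis .
qed

lemma edge_probability_conv_power:
  assumes "1 \<le> \<sigma>"
  shows "edge_probability TYPE('d) \<sigma> r = conv_power (torus_ball_indicator \<sigma> r :: real ^ 'd \<Rightarrow> real) 1 0"
proof -
  define f :: "real ^ 'd \<Rightarrow> real" where "f = torus_ball_indicator \<sigma> r"
  interpret torus_kernel f
    unfolding f_def by (rule torus_kernel_torus_ball_indicator[OF assms(1)])
  let ?U = "torus_uniform :: (real ^ 'd) measure"
  interpret pair_sigma_finite ?U ?U ..
  interpret P: prob_space "?U \<Otimes>\<^sub>M ?U"
    by (intro prob_space_pair prob_space_torus_uniform)
  have even: "f (x - y) = f (y - x)" for x y
    using torus_ball_indicator_even[of \<sigma> r "x - y"] by (simp add: f_def)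
  have ind: "indicator {(x, y). torus_dist \<sigma> x y \<le> r} = (\<lambda>(x, y). f (x - y))"
    by (auto simp: f_def torus_ball_indicator_diff indicator_def fun_eq_iff)
  have int: "integrable (?U \<Otimes>\<^sub>M ?U) (\<lambda>(x, y). f (x - y))"
    using kernel_nonneg kernel_le_1 by (intro P.integrable_const_bound[of _ 1]) auto
  have "edge_probability TYPE('d) \<sigma> r = (\<integral>z. (\<lambda>(x, y). f (x - y)) z \<partial>(?U \<Otimes>\<^sub>M ?U))"
    unfolding edge_probability_def ind[symmetric] by (simp add: space_pair_measure)
  also have "\<dots> = (\<integral>x. (\<integral>y. f (x - y) \<partial>?U) \<partial>?U)"
    using integral_fst[OF int] by simp
  also have "\<dots> = (\<integral>x. (\<integral>y. f y \<partial>?U) \<partial>?U)"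
  proof (rule Bochner_Integration.integral_cong[OF refl])
    fix x
    show "(\<integral>y. f (x - y) \<partial>?U) = (\<integral>y. f y \<partial>?U)"
      using integral_torus_translate[OF _ kernel_periodic, of "- x"] by (simp add: even[of x])
  qed
  also have "\<dots> = (\<integral>y. f y \<partial>?U)"
    by simp
  also have "\<dots> = conv_power f 1 0"
  proof -
    \<comment> \<open>An even indicator is unchanged by multiplication with its reflection: going to
      \<open>z\<close> and back is a single edge. Hence the case of cycle length 2 is the edge
      probability.\<close>
    have "f (0 - z) * f z = f z" for z
      using torus_ball_indicator_even[of \<sigma> r z]
      by (auto simp: f_def torus_ball_indicator_def indicator_def)
    then show ?thesis
      by (simp only: One_nat_def conv_power.simps)
  qed
  finally show ?thesis
    by (simp only: f_def)
qed

section \<open>From the random graph to convolution powers\<close>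

lemma geometric_graph_edges_iff:
  assumes "i \<in> {1..n}" "j \<in> {1..n}" "i \<noteq> j"
  shows "{i, j} \<in> geometric_graph_edges \<sigma> r n x \<longleftrightarrow> torus_dist \<sigma> (x i) (x j) \<le> r"
  using assms torus_dist_commute[of \<sigma> "x i" "x j"]
  by (auto simp: geometric_graph_edges_def doubleton_eq_iff)

text \<open>The indicator of the cycle event is a product of kernels along a path and one closing
  kernel, and the joint law of the points involved is a product of uniform distributions.
  Integrating out the path gives the convolution power.\<close>

lemma cycle_probability_conv_power:
  fixes X :: "nat \<Rightarrow> 'a \<Rightarrow> real ^ 'd"
  assumes "1 \<le> \<sigma>" "2 \<le> q" "prob_space M"
    and indep: "prob_space.indep_vars M (\<lambda>_. borel) X {1..n}"
    and unif: "\<And>i. i \<in> {1..n} \<Longrightarrow> distr M borel (X i) = torus_uniform"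
    and cycle: "labeled_cycle {1..n} q ys"
  shows "cycle_probability M (\<lambda>\<omega>. geometric_graph_edges \<sigma> r n (\<lambda>i. X i \<omega>)) ys =
    conv_power (torus_ball_indicator \<sigma> r :: real ^ 'd \<Rightarrow> real) (q - 1) 0"
proof -
  define f :: "real ^ 'd \<Rightarrow> real" where "f = torus_ball_indicator \<sigma> r"
  interpret torus_kernel f
    unfolding f_def by (rule torus_kernel_torus_ball_indicator[OF assms(1)])
  interpret M: prob_space M
    by fact
  define p where "p i = ys ! i" for i
  \<comment> \<open>Cycle positions run over 0, ..., \<open>k\<close>, with the closing edge from
    \<open>p k\<close> to \<open>p 0\<close>. Since \<open>q \<ge> 2\<close>, these two ends are
    distinct vertices.\<close>
  define k where "k = q - 1"
  define I where "I = p ` {..k}"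
  have ys: "length ys = q" "distinct ys" "set ys \<subseteq> {1..n}" and q: "q = Suc k" "k \<ge> 1"
    using cycle assms(2) by (auto simp: labeled_cycle_def k_def)
  have p_in: "p i \<in> {1..n}" if "i \<le> k" for i
    using that ys q by (auto simp: p_def subset_eq)
  have p_inj: "inj_on p {..k}"
    using ys q by (auto simp: inj_on_def p_def nth_eq_iff_index_eq)
  have I: "I \<subseteq> {1..n}" "I \<noteq> {}" "finite I"
    using p_in by (auto simp: I_def)
  define F where "F x = (\<Prod>i<k. f (x (p i) - x (p (Suc i)))) * f (x (p k) - x (p 0))"
    for x :: "nat \<Rightarrow> real ^ 'd"
  have hd_last: "hd ys = p 0" "last ys = p k"
    using ys(1) q hd_conv_nth[of ys] last_conv_nth[of ys] by (cases ys; simp add: p_def)+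
  have present: "cycle_present (geometric_graph_edges \<sigma> r n x) ys \<longleftrightarrow>
    (\<forall>i<k. torus_dist \<sigma> (x (p i)) (x (p (Suc i))) \<le> r) \<and> torus_dist \<sigma> (x (p k)) (x (p 0)) \<le> r" for x
  proof -
    have "{p i, p j} \<in> geometric_graph_edges \<sigma> r n x \<longleftrightarrow> torus_dist \<sigma> (x (p i)) (x (p j)) \<le> r"
      if "i \<le> k" "j \<le> k" "i \<noteq> j" for i j
      using that p_in p_inj by (intro geometric_graph_edges_iff) (auto simp: inj_on_def)
    then show ?thesis
      using q ys by (auto simp: cycle_present_def hd_last simp flip: p_def)
  qed
  have F_ind: "F x = (if cycle_present (geometric_graph_edges \<sigma> r n x) ys then 1 else 0)" for x
    unfolding present F_def f_def torus_ball_indicator_diff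
    by (auto simp: prod_zero_iff)
  have rv: "X i \<in> borel_measurable M" if "i \<in> {1..n}" for i
    using indep that by (auto simp: M.indep_vars_def)
  let ?D = "distr M (Pi\<^sub>M I (\<lambda>_. borel)) (\<lambda>\<omega>. \<lambda>i\<in>I. X i \<omega>)"
  \<comment> \<open>Independence passes to the vertices on the cycle, the only ones that the event
    depends on.\<close>
  have D: "?D = Pi\<^sub>M I (\<lambda>_. torus_uniform)"
  proof -
    have "?D = Pi\<^sub>M I (\<lambda>i. distr M borel (X i))"
      using M.indep_vars_iff_distr_eq_PiM'[of I X "\<lambda>_. borel"] I rv
        M.indep_vars_subset[OF indep I(1)] by blast
    also have "\<dots> = Pi\<^sub>M I (\<lambda>_. torus_uniform)"
      using unif I by (intro PiM_cong) auto
    finally show ?thesis .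
  qed
  have F_measurable: "F \<in> borel_measurable (Pi\<^sub>M I (\<lambda>_. borel))"
  proof -
    have [measurable]: "(\<lambda>x. x (p i)) \<in> Pi\<^sub>M I (\<lambda>_. borel :: (real ^ 'd) measure) \<rightarrow>\<^sub>M borel"
      if "i \<le> k" for i
      using that by (intro measurable_component_singleton) (auto simp: I_def)
    have [measurable]: "(\<lambda>x. x (p i)) \<in> Pi\<^sub>M I (\<lambda>_. borel :: (real ^ 'd) measure) \<rightarrow>\<^sub>M borel"
      "(\<lambda>x. x (p (Suc i))) \<in> Pi\<^sub>M I (\<lambda>_. borel :: (real ^ 'd) measure) \<rightarrow>\<^sub>M borel"
      if "i \<in> {..<k}" for i
      using that by auto
    show ?thesis
      unfolding F_def by measurable
  qed
  have "cycle_probability M (\<lambda>\<omega>. geometric_graph_edges \<sigma> r n (\<lambda>i. X i \<omega>)) ys =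
      (\<integral>\<omega>. indicator {\<omega> \<in> space M. cycle_present (geometric_graph_edges \<sigma> r n (\<lambda>i. X i \<omega>)) ys} \<omega> \<partial>M)"
    unfolding cycle_probability_def by (simp add: Int_absorb2 subset_eq)
  also have "\<dots> = (\<integral>\<omega>. F (\<lambda>i\<in>I. X i \<omega>) \<partial>M)"
  proof (intro Bochner_Integration.integral_cong refl)
    fix \<omega> assume "\<omega> \<in> space M"
    moreover have "F (\<lambda>i\<in>I. X i \<omega>) = F (\<lambda>i. X i \<omega>)"
      unfolding F_def by (auto simp: I_def intro!: arg_cong2[of _ _ _ _ "(*)"] prod.cong)
    ultimately show "indicator {\<omega> \<in> space M. cycle_present (geometric_graph_edges \<sigma> r n (\<lambda>i. X i \<omega>)) ys} \<omega> =
        F (\<lambda>i\<in>I. X i \<omega>)"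
      by (simp add: F_ind indicator_def)
  qed
  also have "\<dots> = (\<integral>x. F x \<partial>?D)"
    using rv I F_measurable by (subst integral_distr) (auto intro!: measurable_restrict)
  also have "\<dots> = (\<integral>x. F x \<partial>Pi\<^sub>M I (\<lambda>_. torus_uniform))"
    by (simp only: D)
  also have "\<dots> = conv_power f (0 + k) 0"
    using integral_path[OF p_inj, of 0] by (simp add: F_def I_def)
  finally show ?thesis
    by (simp add: k_def f_def)
qed

theorem theorem1:
  fixes \<sigma> :: ereal and r :: real and n q :: nat
    and M :: "'a measure" and X :: "nat \<Rightarrow> 'a \<Rightarrow> real ^ 'd" and ys :: "nat list"
  assumes "1 \<le> \<sigma>" and "0 < r" and "r \<le> 1 / 2" and "2 \<le> q" and "q \<le> n"
    and "prob_space M"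
    and "prob_space.indep_vars M (\<lambda>_. borel) X {1..n}"
    and "\<And>i. i \<in> {1..n} \<Longrightarrow> distr M borel (X i) = torus_uniform"
    and "labeled_cycle {1..n} q ys"
  shows "let \<Theta> = cycle_probability M (\<lambda>\<omega>. geometric_graph_edges \<sigma> r n (\<lambda>i. X i \<omega>)) ys in
         (q = 2 \<longrightarrow> \<Theta> = edge_probability TYPE('d) \<sigma> r) \<and>
         (q > 2 \<longrightarrow>
           ((\<lambda>m :: int ^ 'd.
               fourier_transform (indicator (L_ball \<sigma> r)) ((2 * pi) *\<^sub>R lattice_vec m) ^ q)
             has_sum complex_of_real \<Theta>) UNIV)"
proof -
  interpret torus_kernel "torus_ball_indicator \<sigma> r :: real ^ 'd \<Rightarrow> real"
    by (rule torus_kernel_torus_ball_indicator[OF assms(1)])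
  have \<Theta>: "cycle_probability M (\<lambda>\<omega>. geometric_graph_edges \<sigma> r n (\<lambda>i. X i \<omega>)) ys =
      conv_power (torus_ball_indicator \<sigma> r :: real ^ 'd \<Rightarrow> real) (q - 1) 0"
    using assms by (intro cycle_probability_conv_power)
  \<comment> \<open>The power sum is used at index \<open>q - 2\<close>; as
    \<open>q \<ge> 2\<close>, the truncated subtraction is exact, giving exponent \<open>q\<close>
    and convolution index \<open>q - 1\<close>.\<close>
  have "((\<lambda>m :: int ^ 'd. torus_coeff (\<lambda>x. of_real (torus_ball_indicator \<sigma> r x)) m ^ (q - 2 + 2)) has_sum
      of_real (conv_power (torus_ball_indicator \<sigma> r :: real ^ 'd \<Rightarrow> real) (Suc (q - 2)) 0)) UNIV"
    using assms
    by (intro has_sum_torus_coeff_power torus_ball_indicator_even AE_isCont_torus_ball_indicator)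
  moreover have "q - 2 + 2 = q" "Suc (q - 2) = q - 1"
    using assms(4) by auto
  ultimately have "((\<lambda>m :: int ^ 'd.
      fourier_transform (indicator (L_ball \<sigma> r)) ((2 * pi) *\<^sub>R lattice_vec m) ^ q)
      has_sum of_real (conv_power (torus_ball_indicator \<sigma> r :: real ^ 'd \<Rightarrow> real) (q - 1) 0)) UNIV"
    by (simp only: torus_coeff_torus_ball_indicator[OF assms(1,3)])
  moreover have "edge_probability TYPE('d) \<sigma> r = conv_power (torus_ball_indicator \<sigma> r :: real ^ 'd \<Rightarrow> real) 1 0"
    by (rule edge_probability_conv_power[OF assms(1)])
  ultimately show ?thesis
    by (simp only: Let_def \<Theta>) auto
qed

end
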